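(* (Heisenberg–Robertson uncertainty relation.) Let $(M,\omega)$ be a symplectic manifold with a star product $*$ on $C^\infty(M)((\hbar^{\mathbb{Q}}))$, let $\rho:C^{\infty}(M)((\hbar^{\mathbb{Q}}))\to\mathbb{C}((\hbar^{\mathbb{Q}}))$ be a state, and let $X_1,\dots,X_n\in C^{\infty}(M)((\hbar^{\mathbb{Q}}))$ satisfy $\overline{X_j}=X_j$ for $j=1,\dots,n$. Put $(\Delta X_j)^2:=\rho(X_j*X_j)-(\rho(X_j))^2$. Then, in the ordered field $\mathbb{R}((\hbar^{\mathbb{Q}}))$, $$(\Delta X_1)^2\cdots(\Delta X_n)^2\ \ge\ \det\Big(\tfrac{\hbar}{2}\rho(\{X_j,X_k\}_* )\Big)_{j,k=1}^n ,$$ where $\{X_j,X_k\}_*:=\frac{1}{i\hbar}(X_j*X_k-X_k*X_j)$.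
   Context: For a field $\mathbb{K}$, $\mathbb{K}((\hbar^{\mathbb{Q}}))$ is the field of formal series $a=\sum_{q\in\mathbb{Q}}a_q\hbar^q$, $a_q\in\mathbb{K}$, whose support $\{q:a_q\neq0\}$ is well-ordered (every nonempty subset has a least element), with the usual addition and product. $\mathbb{R}((\hbar^{\mathbb{Q}}))$ is ordered by: $a>0$ iff $a\ne 0$ and $a_{q_0}>0$, where $q_0=\min\operatorname{supp}a$. $\mathbb{C}((\hbar^{\mathbb{Q}}))=\mathbb{R}((\hbar^{\mathbb{Q}}))+i\,\mathbb{R}((\hbar^{\mathbb{Q}}))$. $C^\infty(M)((\hbar^{\mathbb{Q}}))$ is the $\mathbb{C}((\hbar^{\mathbb{Q}}))$-vector space of such series with coefficients in the complex-valued smooth functions on $M$. The overbar denotes coefficientwise complex conjugation ($\hbar$ is real). A star product is an associative $\mathbb{C}((\hbar^{\mathbb{Q}}))$-bilinear product of the form $f*g=\sum_{k=0}^\infty C_k(f,g)\hbar^k$, where the $C_k$ are bidifferential operators (acting coefficientwise) mapping $C^\infty(M)\times C^\infty(M)$ to $C^\infty(M)$, with $C_0(f,g)=fg$, $C_k(1,f)=C_k(f,1)=0$ for $k\ge1$, and $C_1(f,g)-C_1(g,f)=i\{f,g\}$, where $\{\cdot,\cdot\}$ is the Poisson bracket of $(M,\omega)$. A $\mathbb{C}((\hbar^{\mathbb{Q}}))$-linear functional $\rho:C^\infty(M)((\hbar^{\mathbb{Q}}))\to\mathbb{C}((\hbar^{\mathbb{Q}}))$ is positive if $\rho(\overline f*f)\ge0$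 (in particular lies in $\mathbb{R}((\hbar^{\mathbb{Q}}))$) for all $f$; it is a state if moreover $\rho(1)=1$. *)

theory Defs
  imports
    "HOL-Analysis.Derivative"
    "HOL-Library.Function_Algebras"
    "Jordan_Normal_Form.Determinant"
begin

section \<open>Series in rational powers with well-ordered support\<close>

definition well_ordered :: "rat set \<Rightarrow> bool" where
  "well_ordered A \<longleftrightarrow> (\<forall>S\<subseteq>A. S \<noteq> {} \<longrightarrow> (\<exists>m\<in>S. \<forall>x\<in>S. m \<le> x))"

lemma well_ordered_subset: "well_ordered A \<Longrightarrow> B \<subseteq> A \<Longrightarrow> well_ordered B"
  unfolding well_ordered_def by (meson subset_trans)

lemma well_ordered_finite:
  assumes "finite A"
  shows "well_ordered A"
  unfolding well_ordered_def
proof (intro allI impI)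
  fix S assume "S \<subseteq> A" "S \<noteq> {}"
  then have "finite S" "S \<noteq> {}" using assms finite_subset by auto
  then show "\<exists>m\<in>S. \<forall>x\<in>S. m \<le> x" by (intro bexI[of _ "Min S"]) auto
qed

lemma well_ordered_empty [simp]: "well_ordered {}"
  by (simp add: well_ordered_finite)

lemma well_ordered_min:
  assumes "well_ordered A" "S \<subseteq> A" "S \<noteq> {}"
  obtains m where "m \<in> S" "\<And>x. x \<in> S \<Longrightarrow> m \<le> x"
  using assms unfolding well_ordered_def by meson

lemma well_ordered_Un:
  assumes A: "well_ordered A" and B: "well_ordered B"
  shows "well_ordered (A \<union> B)"
  unfolding well_ordered_def
proof (intro allI impI)
  fix S assume S: "S \<subseteq> A \<union> B" "S \<noteq> {}"
  show "\<exists>m\<in>S. \<forall>x\<in>S. m \<le> x"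
  proof (cases "S \<inter> A = {} \<or> S \<inter> B = {}")
    case True
    then have "S \<subseteq> A \<or> S \<subseteq> B" using S(1) by auto
    then show ?thesis using A B S(2) unfolding well_ordered_def by meson
  next
    case False
    obtain m where m: "m \<in> S \<inter> A" "\<And>x. x \<in> S \<inter> A \<Longrightarrow> m \<le> x"
      using well_ordered_min[OF A, of "S \<inter> A"] False by auto
    obtain n where n: "n \<in> S \<inter> B" "\<And>x. x \<in> S \<inter> B \<Longrightarrow> n \<le> x"
      using well_ordered_min[OF B, of "S \<inter> B"] False by auto
    have "min m n \<le> x" if "x \<in> S" for x
    proof (cases "x \<in> A")
      case True
      then have "m \<le> x" using m(2) that by simp
      then show ?thesis by simp
    next
      case False
      then have "x \<in> B" using S(1) that by auto
      then have "n \<le> x" using n(2) that by simp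
      then show ?thesis by simp
    qed
    moreover have "min m n \<in> S" using m n by (auto simp: min_def)
    ultimately show ?thesis by (intro bexI[of _ "min m n"]) auto
  qed
qed

lemma well_ordered_initial:
  assumes "\<And>b. well_ordered {q \<in> A. q \<le> b}"
  shows "well_ordered A"
  unfolding well_ordered_def
proof (intro allI impI)
  fix S assume S: "S \<subseteq> A" "S \<noteq> {}"
  then obtain s where s: "s \<in> S" by auto
  obtain m where m: "m \<in> {q \<in> S. q \<le> s}" "\<And>x. x \<in> {q \<in> S. q \<le> s} \<Longrightarrow> m \<le> x"
    by (rule well_ordered_min[OF assms[of s], of "{q \<in> S. q \<le> s}"]) (use S s in auto)
  have "m \<le> x" if "x \<in> S" for x
    using m that by (cases "x \<le> s") auto
  then show "\<exists>m\<in>S. \<forall>x\<in>S. m \<le> x" using m(1) by auto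
qed

definition sumset :: "rat set \<Rightarrow> rat set \<Rightarrow> rat set" where
  "sumset A B = {a + b | a b. a \<in> A \<and> b \<in> B}"

lemma sumsetI [intro]: "a \<in> A \<Longrightarrow> b \<in> B \<Longrightarrow> a + b \<in> sumset A B"
  unfolding sumset_def by auto

lemma finite_antidiagonal:
  assumes A: "well_ordered A" and B: "well_ordered B"
  shows "finite {a \<in> A. q - a \<in> B}"
proof (rule ccontr)
  define F where "F = {a \<in> A. q - a \<in> B}"
  assume "infinite {a \<in> A. q - a \<in> B}"
  then have inf: "infinite F" by (simp add: F_def)
  have max: "\<exists>m\<in>T. \<forall>x\<in>T. x \<le> m" if T: "T \<subseteq> F" "T \<noteq> {}" for T
  proof -
    obtain m where m: "m \<in> (\<lambda>a. q - a) ` T" "\<And>x. x \<in> (\<lambda>a. q - a) ` T \<Longrightarrow> m \<le> x"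
      by (rule well_ordered_min[OF B, of "(\<lambda>a. q - a) ` T"]) (use T in \<open>auto simp: F_def\<close>)
    from m(1) obtain t where t: "t \<in> T" "m = q - t" by auto
    have "x \<le> t" if "x \<in> T" for x using m(2)[of "q - x"] that t by auto
    then show ?thesis using t by auto
  qed
  define P where "P = {s \<in> F. infinite {x \<in> F. x < s}}"
  have below: "\<exists>r\<in>T. infinite {x \<in> T. x < r}" if T: "T \<subseteq> F" "infinite T" for T
  proof -
    obtain r where r: "r \<in> T" "\<forall>x\<in>T. x \<le> r" using max[OF T(1)] T(2) by fastforce
    have "infinite (T - {r})" using T(2) by simp
    moreover have "T - {r} = {x \<in> T. x < r}" using r(2) by (auto simp: less_le)
    ultimately show ?thesis using r(1) by auto
  qed
  have "P \<noteq> {}" using below[OF _ inf] by (auto simp: P_def)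
  moreover have "P \<subseteq> A" by (auto simp: P_def F_def)
  ultimately obtain p where p: "p \<in> P" "\<And>x. x \<in> P \<Longrightarrow> p \<le> x"
    using well_ordered_min[OF A, of P] by auto
  have "infinite {x \<in> F. x < p}" using p(1) by (simp add: P_def)
  then obtain r where r: "r \<in> F" "r < p" "infinite {x \<in> {x \<in> F. x < p}. x < r}"
    using below[of "{x \<in> F. x < p}"] by auto
  have "{x \<in> {x \<in> F. x < p}. x < r} \<subseteq> {x \<in> F. x < r}" by auto
  then have "infinite {x \<in> F. x < r}" using r(3) finite_subset by auto
  then have "r \<in> P" using r(1) by (simp add: P_def)
  then show False using p(2) r(2) by force
qed

lemma well_ordered_sumset:
  assumes A: "well_ordered A" and B: "well_ordered B"
  shows "well_ordered (sumset A B)"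
  unfolding well_ordered_def
proof (intro allI impI)
  fix S assume S: "S \<subseteq> sumset A B" "S \<noteq> {}"
  show "\<exists>m\<in>S. \<forall>x\<in>S. m \<le> x"
  proof (rule ccontr)
    assume no: "\<not> ?thesis"
    define L where "L a t \<longleftrightarrow> (\<forall>a'\<in>A. \<forall>b'\<in>B. a' + b' \<in> S \<longrightarrow> a' + b' < t \<longrightarrow> a \<le> a')" for a t
    define R where "R = {b \<in> B. \<exists>a\<in>A. a + b \<in> S \<and> L a (a + b)}"
    have step: "\<exists>a\<in>A. \<exists>b\<in>B. a + b \<in> S \<and> a + b < t \<and> L a t" if "t \<in> S" for t
    proof -
      define W where "W = {a \<in> A. \<exists>b\<in>B. a + b \<in> S \<and> a + b < t}"
      obtain u where u: "u \<in> S" "\<not> t \<le> u" using no \<open>t \<in> S\<close> by auto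
      then obtain a b where "a \<in> A" "b \<in> B" "u = a + b" using S(1) by (auto simp: sumset_def)
      then have "W \<noteq> {}" using u by (auto simp: W_def not_le)
      then obtain m where m: "m \<in> W" "\<And>x. x \<in> W \<Longrightarrow> m \<le> x"
        using well_ordered_min[OF A, of W] by (auto simp: W_def)
      have "L m t" using m(2) by (auto simp: L_def W_def)
      then show ?thesis using m(1) by (auto simp: W_def)
    qed
    have R: "b \<in> R" if "a \<in> A" "b \<in> B" "a + b \<in> S" "a + b < t" "L a t" for a b t
    proof -
      have "L a (a + b)" using that(4,5) unfolding L_def by (meson less_trans)
      then show ?thesis using that by (auto simp: R_def)
    qed
    obtain s where "s \<in> S" using S(2) by auto
    then have "R \<noteq> {}" using step R by (metis empty_iff)
    then obtain b where b: "b \<in> R" "\<And>x. x \<in> R \<Longrightarrow> b \<le> x"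
      using well_ordered_min[OF B, of R] by (auto simp: R_def)
    then obtain a where a: "a \<in> A" "a + b \<in> S" "L a (a + b)"
      by (auto simp: R_def)
    from step[OF a(2)] obtain a1 b1 where ab1: "a1 \<in> A" "b1 \<in> B" "a1 + b1 \<in> S"
      "a1 + b1 < a + b" "L a1 (a + b)" by auto
    have "b \<le> b1" using b(2) R[OF ab1] by simp
    moreover have "a \<le> a1" using a(3) ab1 by (auto simp: L_def)
    ultimately show False using ab1(4) by linarith
  qed
qed

typedef (overloaded) 'a hahn = "{f :: rat \<Rightarrow> 'a::zero. well_ordered {q. f q \<noteq> 0}}"
  morphisms hcoeff Abs_hahn
  by (rule exI[of _ "\<lambda>_. 0"]) simp

setup_lifting type_definition_hahn

definition hsupp :: "'a::zero hahn \<Rightarrow> rat set" where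
  "hsupp f = {q. hcoeff f q \<noteq> 0}"

lemma well_ordered_hsupp [simp]: "well_ordered (hsupp f)"
  unfolding hsupp_def by transfer simp

lemma hahn_eqI: "(\<And>q. hcoeff f q = hcoeff g q) \<Longrightarrow> f = g"
  by (simp add: hcoeff_inject[symmetric] ext)

lemma in_hsupp: "q \<in> hsupp f \<longleftrightarrow> hcoeff f q \<noteq> 0"
  by (simp add: hsupp_def)

instantiation hahn :: (zero) zero
begin
lift_definition zero_hahn :: "'a hahn" is "\<lambda>_. 0" by simp
instance ..
end

lemma hcoeff_0 [simp]: "hcoeff 0 q = 0"
  by transfer simp

lemma hsupp_0 [simp]: "hsupp 0 = {}"
  by (simp add: hsupp_def)

lemma hsupp_empty_iff: "hsupp f = {} \<longleftrightarrow> f = 0"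
  by (auto simp: in_hsupp set_eq_iff intro: hahn_eqI)

instantiation hahn :: (comm_monoid_add) comm_monoid_add
begin
lift_definition plus_hahn :: "'a hahn \<Rightarrow> 'a hahn \<Rightarrow> 'a hahn" is "\<lambda>f g q. f q + g q"
  subgoal for f g
    by (rule well_ordered_subset[OF well_ordered_Un[of "{q. f q \<noteq> 0}" "{q. g q \<noteq> 0}"]]) auto
  done
instance
proof
  fix f g h :: "'a hahn"
  show "f + g + h = f + (g + h)" by transfer (simp add: add.assoc)
  show "f + g = g + f" by transfer (simp add: add.commute)
  show "0 + f = f" by transfer simp
qed
end

lemma hcoeff_add [simp]: "hcoeff (f + g) q = hcoeff f q + hcoeff g q"
  by transfer simp

lemma hcoeff_sum: "hcoeff (sum f I) q = (\<Sum>i\<in>I. hcoeff (f i) q)"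
  by (induction I rule: infinite_finite_induct) auto

instantiation hahn :: (ab_group_add) ab_group_add
begin
lift_definition uminus_hahn :: "'a hahn \<Rightarrow> 'a hahn" is "\<lambda>f q. - f q" by simp
lift_definition minus_hahn :: "'a hahn \<Rightarrow> 'a hahn \<Rightarrow> 'a hahn" is "\<lambda>f g q. f q - g q"
  subgoal for f g
    by (rule well_ordered_subset[OF well_ordered_Un[of "{q. f q \<noteq> 0}" "{q. g q \<noteq> 0}"]]) auto
  done
instance
proof
  fix f g :: "'a hahn"
  show "- f + f = 0" by transfer simp
  show "f - g = f + - g" by transfer simp
qed
end

lemma hcoeff_uminus [simp]: "hcoeff (- f) q = - hcoeff f q"
  by transfer simp

lemma hcoeff_diff [simp]: "hcoeff (f - g) q = hcoeff f q - hcoeff g q"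
  by transfer simp

lift_definition hmonom :: "rat \<Rightarrow> 'a::zero \<Rightarrow> 'a hahn" is "\<lambda>p a q. if q = p then a else 0"
  subgoal for p a
    by (rule well_ordered_subset[OF well_ordered_finite[of "{p}"]]) auto
  done

lemma hcoeff_hmonom: "hcoeff (hmonom p a) q = (if q = p then a else 0)"
  by transfer simp

instantiation hahn :: (comm_ring_1) "{one, times}"
begin
definition one_hahn :: "'a hahn" where "1 = hmonom 0 1"
lift_definition times_hahn :: "'a hahn \<Rightarrow> 'a hahn \<Rightarrow> 'a hahn" is
  "\<lambda>f g q. \<Sum>a | f a \<noteq> 0 \<and> g (q - a) \<noteq> 0. f a * g (q - a)"
  subgoal premises prems for f g
  proof (rule well_ordered_subset[OF well_ordered_sumset[OF prems]], rule subsetI, rule ccontr)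
    fix q assume q: "q \<in> {q. (\<Sum>a | f a \<noteq> 0 \<and> g (q - a) \<noteq> 0. f a * g (q - a)) \<noteq> 0}"
      "q \<notin> sumset {q. f q \<noteq> 0} {q. g q \<noteq> 0}"
    have "\<not> (f a \<noteq> 0 \<and> g (q - a) \<noteq> 0)" for a
      using sumsetI[of a "{q. f q \<noteq> 0}" "q - a" "{q. g q \<noteq> 0}"] q(2) by auto
    then have "{a. f a \<noteq> 0 \<and> g (q - a) \<noteq> 0} = {}" by simp
    then show False using q(1) by (simp del: Collect_empty_eq)
  qed
  done
instance ..
end

lemma hcoeff_1: "hcoeff 1 q = (if q = 0 then 1 else 0)"
  by (simp add: one_hahn_def hcoeff_hmonom)

lemma hcoeff_times:
  "hcoeff (f * g) q = (\<Sum>a | a \<in> hsupp f \<and> q - a \<in> hsupp g. hcoeff f a * hcoeff g (q - a))"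
  unfolding hsupp_def by transfer simp

lemma hcoeff_times_superset:
  assumes "finite T" "\<And>a. hcoeff f a \<noteq> 0 \<Longrightarrow> hcoeff g (q - a) \<noteq> 0 \<Longrightarrow> a \<in> T"
  shows "hcoeff (f * g) q = (\<Sum>a\<in>T. hcoeff f a * hcoeff g (q - a))"
  unfolding hcoeff_times
proof (rule sum.mono_neutral_left[OF assms(1)])
  show "{a. a \<in> hsupp f \<and> q - a \<in> hsupp g} \<subseteq> T" using assms(2) by (auto simp: in_hsupp)
  show "\<forall>i\<in>T - {a. a \<in> hsupp f \<and> q - a \<in> hsupp g}. hcoeff f i * hcoeff g (q - i) = 0"
  proof
    fix i assume "i \<in> T - {a. a \<in> hsupp f \<and> q - a \<in> hsupp g}"
    then have "hcoeff f i = 0 \<or> hcoeff g (q - i) = 0" by (simp add: in_hsupp)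
    then show "hcoeff f i * hcoeff g (q - i) = 0" by (elim disjE) simp_all
  qed
qed

lemma hcoeff_times_wo:
  assumes "well_ordered A" "well_ordered B" "hsupp f \<subseteq> A" "hsupp g \<subseteq> B"
  shows "hcoeff (f * g) q = (\<Sum>a | a \<in> A \<and> q - a \<in> B. hcoeff f a * hcoeff g (q - a))"
proof (rule hcoeff_times_superset)
  show "finite {a. a \<in> A \<and> q - a \<in> B}"
    using finite_antidiagonal[OF assms(1,2)] by simp
  show "a \<in> {a. a \<in> A \<and> q - a \<in> B}" if "hcoeff f a \<noteq> 0" "hcoeff g (q - a) \<noteq> 0" for a
    using that assms(3,4) by (auto simp: in_hsupp subset_iff)
qed

lemma hsupp_times: "hsupp (f * g) \<subseteq> sumset (hsupp f) (hsupp g)"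
proof
  fix q assume "q \<in> hsupp (f * g)"
  then have "(\<Sum>a | a \<in> hsupp f \<and> q - a \<in> hsupp g. hcoeff f a * hcoeff g (q - a)) \<noteq> 0"
    by (simp only: in_hsupp hcoeff_times not_False_eq_True)
  then obtain a where "a \<in> {a. a \<in> hsupp f \<and> q - a \<in> hsupp g}"
    by (rule sum.not_neutral_contains_not_neutral)
  then have "a \<in> hsupp f" "q - a \<in> hsupp g" by simp_all
  then show "q \<in> sumset (hsupp f) (hsupp g)"
    using sumsetI[of a "hsupp f" "q - a" "hsupp g"] by simp
qed

instance hahn :: (comm_ring_1) comm_ring_1
proof
  fix f g h :: "'a hahn"
  define A B C where ABC: "A = hsupp f" "B = hsupp g" "C = hsupp h"
  have wo: "well_ordered A" "well_ordered B" "well_ordered C" by (simp_all add: ABC)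
  show "f * g * h = f * (g * h)"
  proof (rule hahn_eqI)
    fix q
    define D E where DE: "D = sumset A B" "E = sumset B C"
    have woDE: "well_ordered D" "well_ordered E" by (simp_all add: DE wo well_ordered_sumset)
    have sub: "hsupp (f * g) \<subseteq> D" "hsupp (g * h) \<subseteq> E" by (simp_all add: DE ABC hsupp_times)
    define I where "I = {d. d \<in> D \<and> q - d \<in> C}"
    define J where "J = {a. a \<in> A \<and> q - a \<in> E}"
    define K where "K d = {a. a \<in> A \<and> d - a \<in> B}" for d
    define L where "L a = {b. b \<in> B \<and> q - a - b \<in> C}" for a
    have fin: "finite I" "finite J" "finite (K d)" "finite (L a)" for a d
      unfolding I_def J_def K_def L_def using finite_antidiagonal wo woDE by simp_all
    have "hcoeff (f * g * h) q = (\<Sum>d\<in>I. hcoeff (f * g) d * hcoeff h (q - d))"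
      unfolding I_def by (rule hcoeff_times_wo[OF woDE(1) wo(3) sub(1)]) (simp add: ABC)
    also have "\<dots> = (\<Sum>d\<in>I. \<Sum>a\<in>K d. hcoeff f a * hcoeff g (d - a) * hcoeff h (q - d))"
      unfolding K_def by (subst hcoeff_times_wo[OF wo(1,2)]) (simp_all add: ABC sum_distrib_right)
    also have "\<dots> = (\<Sum>(d,a)\<in>Sigma I K. hcoeff f a * hcoeff g (d - a) * hcoeff h (q - d))"
      by (rule sum.Sigma) (simp_all add: fin)
    also have "\<dots> = (\<Sum>(a,b)\<in>Sigma J L. hcoeff f a * (hcoeff g b * hcoeff h (q - a - b)))"
    proof (rule sum.reindex_bij_witness[where i = "\<lambda>(a,b). (a + b, a)" and j = "\<lambda>(d,a). (a, d - a)"])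
      show "(\<lambda>(d,a). (a, d - a)) x \<in> Sigma J L" if "x \<in> Sigma I K" for x
      proof -
        obtain d a where x: "x = (d, a)" by (cases x)
        then have *: "q - d \<in> C" "a \<in> A" "d - a \<in> B" using that by (auto simp: I_def K_def)
        have "(d - a) + (q - d) \<in> E" unfolding DE(2) by (rule sumsetI) (rule *)+
        then have "q - a \<in> E" by simp
        then show ?thesis using * x by (simp add: J_def L_def)
      qed
      show "(\<lambda>(a,b). (a + b, a)) x \<in> Sigma I K" if "x \<in> Sigma J L" for x
      proof -
        obtain a b where x: "x = (a, b)" by (cases x)
        then have *: "a \<in> A" "b \<in> B" "q - a - b \<in> C" using that by (auto simp: J_def L_def)
        have "a + b \<in> D" unfolding DE using * by auto
        then show ?thesis using * x by (simp add: I_def K_def diff_diff_eq)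
      qed
      show "(\<lambda>(a,b). (a + b, a)) ((\<lambda>(d,a). (a, d - a)) x) = x" for x :: "rat \<times> rat"
        by (cases x) simp
      show "(\<lambda>(d,a). (a, d - a)) ((\<lambda>(a,b). (a + b, a)) x) = x" for x :: "rat \<times> rat"
        by (cases x) simp
      show "(case (case x of (d, a) \<Rightarrow> (a, d - a)) of (a, b) \<Rightarrow> hcoeff f a * (hcoeff g b * hcoeff h (q - a - b)))
          = (case x of (d, a) \<Rightarrow> hcoeff f a * hcoeff g (d - a) * hcoeff h (q - d))" for x
        by (cases x) (simp add: mult.assoc)
    qed
    also have "\<dots> = (\<Sum>a\<in>J. \<Sum>b\<in>L a. hcoeff f a * (hcoeff g b * hcoeff h (q - a - b)))"
      by (rule sum.Sigma[symmetric]) (simp_all add: fin)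
    also have "\<dots> = (\<Sum>a\<in>J. hcoeff f a * hcoeff (g * h) (q - a))"
      unfolding L_def by (subst hcoeff_times_wo[OF wo(2,3)]) (simp_all add: ABC sum_distrib_left)
    also have "\<dots> = hcoeff (f * (g * h)) q"
      unfolding J_def by (rule hcoeff_times_wo[OF wo(1) woDE(2) _ sub(2), symmetric]) (simp add: ABC)
    finally show "hcoeff (f * g * h) q = hcoeff (f * (g * h)) q" .
  qed
  show "f * g = g * f"
  proof (rule hahn_eqI)
    fix q
    show "hcoeff (f * g) q = hcoeff (g * f) q"
      unfolding hcoeff_times
      by (rule sum.reindex_bij_witness[where i = "\<lambda>a. q - a" and j = "\<lambda>a. q - a"])
        (auto simp: mult.commute)
  qed
  show "1 * f = f"
  proof (rule hahn_eqI)
    fix q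
    have "hcoeff (1 * f) q = (\<Sum>a\<in>{0}. hcoeff 1 a * hcoeff f (q - a))"
      by (rule hcoeff_times_superset) (auto simp: hcoeff_1 split: if_splits)
    then show "hcoeff (1 * f) q = hcoeff f q" by (simp add: hcoeff_1)
  qed
  show "(f + g) * h = f * h + g * h"
  proof (rule hahn_eqI)
    fix q
    have *: "hcoeff (k * h) q = (\<Sum>a | a \<in> A \<union> B \<and> q - a \<in> C. hcoeff k a * hcoeff h (q - a))"
      if "hsupp k \<subseteq> A \<union> B" for k
      by (rule hcoeff_times_wo[OF well_ordered_Un[OF wo(1,2)] wo(3) that]) (simp add: ABC)
    have sub: "hsupp (f + g) \<subseteq> A \<union> B" "hsupp f \<subseteq> A \<union> B" "hsupp g \<subseteq> A \<union> B"
      by (auto simp: ABC in_hsupp)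
    show "hcoeff ((f + g) * h) q = hcoeff (f * h + g * h) q"
      by (simp only: hcoeff_add *[OF sub(1)] *[OF sub(2)] *[OF sub(3)] distrib_right sum.distrib)
  qed
  show "(0::'a hahn) \<noteq> 1"
  proof
    assume "(0::'a hahn) = 1"
    then have "hcoeff (0::'a hahn) 0 = hcoeff 1 0" by simp
    then show False by (simp add: hcoeff_1)
  qed
qed

lemma hcoeff_hmonom_times: "hcoeff (hmonom p c * f) q = c * hcoeff f (q - p)"
proof -
  have "hcoeff (hmonom p c * f) q = (\<Sum>a\<in>{p}. hcoeff (hmonom p c) a * hcoeff f (q - a))"
    by (rule hcoeff_times_superset) (auto simp: hcoeff_hmonom split: if_splits)
  then show ?thesis by (simp add: hcoeff_hmonom)
qed

text \<open>The exponent of the leading term of a nonzero series.\<close>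

definition hval :: "'a::zero hahn \<Rightarrow> rat" where
  "hval f = (LEAST q. q \<in> hsupp f)"

lemma hval_props:
  assumes "f \<noteq> 0"
  shows hcoeff_hval: "hcoeff f (hval f) \<noteq> 0"
    and hcoeff_less_hval: "q < hval f \<Longrightarrow> hcoeff f q = 0"
proof -
  have "hsupp f \<noteq> {}" using assms by (simp add: hsupp_empty_iff)
  then obtain m where m: "m \<in> hsupp f" "\<And>x. x \<in> hsupp f \<Longrightarrow> m \<le> x"
    using well_ordered_min[OF well_ordered_hsupp subset_refl] by auto
  have "hval f = m" unfolding hval_def by (rule Least_equality) (use m in auto)
  then show "hcoeff f (hval f) \<noteq> 0" "q < hval f \<Longrightarrow> hcoeff f q = 0"
    using m by (auto simp: in_hsupp not_le[symmetric])
qed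

lemma hval_eqI:
  assumes "hcoeff f p \<noteq> 0" "\<And>q. q < p \<Longrightarrow> hcoeff f q = 0"
  shows "hval f = p"
  unfolding hval_def by (rule Least_equality) (use assms in \<open>auto simp: in_hsupp not_less[symmetric]\<close>)

lemma hcoeff_times_low:
  assumes f: "\<And>p. p < a \<Longrightarrow> hcoeff f p = 0" and g: "\<And>p. p < b \<Longrightarrow> hcoeff g p = 0"
  shows "hcoeff (f * g) (a + b) = hcoeff f a * hcoeff g b"
    and "q < a + b \<Longrightarrow> hcoeff (f * g) q = 0"
proof -
  have "hcoeff (f * g) (a + b) = (\<Sum>x\<in>{a}. hcoeff f x * hcoeff g (a + b - x))"
  proof (rule hcoeff_times_superset)
    fix x assume "hcoeff f x \<noteq> 0" "hcoeff g (a + b - x) \<noteq> 0"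
    then have "a \<le> x" "b \<le> a + b - x" using f g by (auto simp: not_less[symmetric])
    then show "x \<in> {a}" by simp
  qed simp
  then show "hcoeff (f * g) (a + b) = hcoeff f a * hcoeff g b" by simp
  assume q: "q < a + b"
  have "hcoeff (f * g) q = (\<Sum>x\<in>{}. hcoeff f x * hcoeff g (q - x))"
  proof (rule hcoeff_times_superset)
    fix x assume "hcoeff f x \<noteq> 0" "hcoeff g (q - x) \<noteq> 0"
    then have "a \<le> x" "b \<le> q - x" using f g by (auto simp: not_less[symmetric])
    then show "x \<in> {}" using q by simp
  qed simp
  then show "hcoeff (f * g) q = 0" by simp
qed

instance hahn :: (idom) idom
proof
  fix f g :: "'a hahn"
  assume fg: "f \<noteq> 0" "g \<noteq> 0"
  have "hcoeff (f * g) (hval f + hval g) = hcoeff f (hval f) * hcoeff g (hval g)"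
    by (rule hcoeff_times_low) (simp_all add: hcoeff_less_hval fg)
  also have "\<dots> \<noteq> 0" using fg by (simp add: hcoeff_hval)
  finally show "f * g \<noteq> 0" by auto
qed

subsection \<open>Inverses\<close>

lemma hcoeff_power_low:
  assumes "\<And>p. p < a \<Longrightarrow> hcoeff u p = 0" "q < of_nat n * a"
  shows "hcoeff (u ^ n) q = 0"
  using assms(2)
proof (induction n arbitrary: q)
  case 0
  then show ?case by (simp add: hcoeff_1)
next
  case (Suc n)
  show ?case unfolding power_Suc
    by (rule hcoeff_times_low(2)[where a = a and b = "of_nat n * a"])
      (use Suc assms(1) in \<open>auto simp: algebra_simps\<close>)
qed

lemma hcoeff_times_cong:
  assumes "\<And>p. p < 0 \<Longrightarrow> hcoeff f p = 0" "\<And>p. p \<le> q \<Longrightarrow> hcoeff g p = hcoeff h p"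
  shows "hcoeff (f * g) q = hcoeff (f * h) q"
proof -
  have eq: "hcoeff g (q - a) = hcoeff h (q - a)" if "a \<in> hsupp f" for a
  proof -
    have "0 \<le> a" using that assms(1)[of a] by (cases "a < 0") (simp_all add: in_hsupp)
    then show ?thesis using assms(2)[of "q - a"] by simp
  qed
  then have "{a. a \<in> hsupp f \<and> q - a \<in> hsupp g} = {a. a \<in> hsupp f \<and> q - a \<in> hsupp h}"
    by (auto simp: in_hsupp)
  with eq show ?thesis unfolding hcoeff_times by (intro sum.cong) auto
qed

lemma hahn_geometric:
  fixes u :: "'a::comm_ring_1 hahn"
  assumes "\<And>p. p \<le> 0 \<Longrightarrow> hcoeff u p = 0"
  shows "\<exists>g. (1 - u) * g = 1"
proof (cases "u = 0")
  case True
  then show ?thesis by (intro exI[of _ 1]) simp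
next
  case False
  define a where "a = hval u"
  have a: "0 < a" using hcoeff_hval[OF False] assms by (auto simp: a_def not_le[symmetric])
  have low: "\<And>p. p < a \<Longrightarrow> hcoeff u p = 0" using hcoeff_less_hval[OF False] by (simp add: a_def)
  define P where "P N = (\<Sum>n<N. u ^ n)" for N
  have stable: "hcoeff (P M) q = hcoeff (P N) q" if "N \<le> M" "q < of_nat N * a" for q N M
  proof -
    have "hcoeff (u ^ n) q = 0" if "n \<in> {..<M} - {..<N}" for n
    proof (rule hcoeff_power_low[OF low])
      have "of_nat N * a \<le> of_nat n * a" using that a by (intro mult_right_mono) auto
      then show "q < of_nat n * a" using \<open>q < of_nat N * a\<close> by linarith
    qed
    then show ?thesis unfolding P_def hcoeff_sum using that(1)
      by (intro sum.mono_neutral_right) auto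
  qed
  define N where "N q = Suc (nat \<lceil>q / a\<rceil>)" for q
  have N: "q < of_nat (N q) * a" for q
  proof -
    have "q / a < of_nat (N q)" unfolding N_def by (simp add: of_nat_nat) linarith
    then show ?thesis using a by (simp add: field_simps)
  qed
  have mono: "N p \<le> N q" if "p \<le> q" for p q
    unfolding N_def using that a by (simp add: nat_mono ceiling_mono divide_right_mono)
  have eq: "hcoeff (P (N p)) p = hcoeff (P (N q)) p" if "p \<le> q" for p q
    using stable[OF mono[OF that] N] by simp
  have "well_ordered {q. hcoeff (P (N q)) q \<noteq> 0}"
  proof (rule well_ordered_initial)
    fix b
    show "well_ordered {q \<in> {q. hcoeff (P (N q)) q \<noteq> 0}. q \<le> b}"
      by (rule well_ordered_subset[OF well_ordered_hsupp[of "P (N b)"]])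
        (auto simp: in_hsupp eq[of _ b])
  qed
  then have "\<exists>g. \<forall>q. hcoeff g q = hcoeff (P (N q)) q"
    by (intro exI[of _ "Abs_hahn (\<lambda>q. hcoeff (P (N q)) q)"]) (simp add: Abs_hahn_inverse)
  then obtain g where g: "\<And>q. hcoeff g q = hcoeff (P (N q)) q" by auto
  have "(1 - u) * g = 1"
  proof (rule hahn_eqI)
    fix q
    have "hcoeff ((1 - u) * g) q = hcoeff ((1 - u) * P (N q)) q"
      by (rule hcoeff_times_cong) (auto simp: g eq hcoeff_1 assms)
    also have "(1 - u) * P (N q) = 1 - u ^ N q"
      unfolding P_def by (rule one_diff_power_eq[symmetric])
    also have "hcoeff \<dots> q = hcoeff 1 q"
      using hcoeff_power_low[OF low N] by simp
    finally show "hcoeff ((1 - u) * g) q = hcoeff 1 q" .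
  qed
  then show ?thesis by auto
qed

lemma hahn_inverse_ex:
  fixes f :: "'a::field hahn"
  assumes "f \<noteq> 0"
  shows "\<exists>g. f * g = 1"
proof -
  define m where "m = hmonom (- hval f) (inverse (hcoeff f (hval f)))"
  have m: "hcoeff (m * f) q = inverse (hcoeff f (hval f)) * hcoeff f (q + hval f)" for q
    by (simp add: m_def hcoeff_hmonom_times)
  have "hcoeff (1 - m * f) p = 0" if "p \<le> 0" for p
    using that hcoeff_less_hval[OF assms, of "p + hval f"] hcoeff_hval[OF assms]
    by (cases "p = 0") (simp_all add: m hcoeff_1)
  from hahn_geometric[OF this] obtain g where "(1 - (1 - m * f)) * g = 1" by auto
  then have "f * (m * g) = 1" by (simp add: ac_simps)
  then show ?thesis by auto
qed

instantiation hahn :: (field) inverse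
begin

definition inverse_hahn :: "'a hahn \<Rightarrow> 'a hahn" where
  "inverse_hahn f = (if f = 0 then 0 else THE g. f * g = 1)"

definition divide_hahn :: "'a hahn \<Rightarrow> 'a hahn \<Rightarrow> 'a hahn" where
  "divide_hahn f g = f * inverse g"

instance ..

end

instance hahn :: (field) field
proof
  fix f g :: "'a hahn"
  show "inverse f * f = 1" if "f \<noteq> 0"
  proof -
    have "\<exists>!g. f * g = 1"
      using hahn_inverse_ex[OF that] that by (metis mult_left_cancel)
    then have "f * (THE g. f * g = 1) = 1" by (rule theI')
    then show ?thesis using that by (simp add: inverse_hahn_def mult.commute)
  qed
qed (simp_all add: inverse_hahn_def divide_hahn_def)

subsection \<open>Order\<close>

definition hpos :: "'a::{zero,ord} hahn \<Rightarrow> bool" where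
  "hpos f \<longleftrightarrow> f \<noteq> 0 \<and> 0 < hcoeff f (hval f)"

lemma hpos_iff:
  fixes f :: "'a::linordered_idom hahn"
  shows "hpos f \<longleftrightarrow> (\<exists>q. 0 < hcoeff f q \<and> (\<forall>p<q. hcoeff f p = 0))"
proof
  show "\<exists>q. 0 < hcoeff f q \<and> (\<forall>p<q. hcoeff f p = 0)" if "hpos f"
    using that hcoeff_less_hval[of f] by (auto simp: hpos_def)
  assume "\<exists>q. 0 < hcoeff f q \<and> (\<forall>p<q. hcoeff f p = 0)"
  then obtain q where q: "0 < hcoeff f q" "\<And>p. p < q \<Longrightarrow> hcoeff f p = 0" by auto
  moreover have "hval f = q" by (rule hval_eqI) (use q in auto)
  ultimately show "hpos f" by (auto simp: hpos_def)
qed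

lemma hpos_add:
  fixes f g :: "'a::linordered_idom hahn"
  assumes "hpos f" "hpos g"
  shows "hpos (f + g)"
proof -
  obtain p where p: "0 < hcoeff f p" "\<And>r. r < p \<Longrightarrow> hcoeff f r = 0" using assms by (auto simp: hpos_iff)
  obtain q where q: "0 < hcoeff g q" "\<And>r. r < q \<Longrightarrow> hcoeff g r = 0" using assms by (auto simp: hpos_iff)
  show ?thesis unfolding hpos_iff
  proof (intro exI[of _ "min p q"] conjI allI impI)
    show "0 < hcoeff (f + g) (min p q)"
      using p q by (cases p q rule: linorder_cases) (auto simp: min_def)
    show "hcoeff (f + g) r = 0" if "r < min p q" for r using p(2) q(2) that by simp
  qed
qed

lemma hpos_mult:
  fixes f g :: "'a::linordered_idom hahn"
  assumes "hpos f" "hpos g"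
  shows "hpos (f * g)"
proof -
  obtain p where p: "0 < hcoeff f p" "\<And>r. r < p \<Longrightarrow> hcoeff f r = 0" using assms by (auto simp: hpos_iff)
  obtain q where q: "0 < hcoeff g q" "\<And>r. r < q \<Longrightarrow> hcoeff g r = 0" using assms by (auto simp: hpos_iff)
  show ?thesis unfolding hpos_iff
    using hcoeff_times_low[OF p(2) q(2)] p(1) q(1) by (intro exI[of _ "p + q"]) auto
qed

lemma hpos_cases:
  fixes f :: "'a::linordered_idom hahn"
  shows "f = 0 \<or> hpos f \<or> hpos (- f)"
proof (cases "f = 0")
  case False
  then have "hcoeff f (hval f) \<noteq> 0" "\<And>q. q < hval f \<Longrightarrow> hcoeff f q = 0"
    by (simp_all add: hcoeff_hval hcoeff_less_hval)
  then show ?thesis unfolding hpos_iff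
    by (cases "0 < hcoeff f (hval f)") (auto simp: not_less intro!: exI[of _ "hval f"])
qed simp

lemma not_hpos_0 [simp]: "\<not> hpos 0"
  by (simp add: hpos_def)

instantiation hahn :: (linordered_idom) linordered_idom
begin

definition less_hahn :: "'a hahn \<Rightarrow> 'a hahn \<Rightarrow> bool" where
  "f < g \<longleftrightarrow> hpos (g - f)"

definition less_eq_hahn :: "'a hahn \<Rightarrow> 'a hahn \<Rightarrow> bool" where
  "f \<le> g \<longleftrightarrow> f = g \<or> hpos (g - f)"

definition abs_hahn :: "'a hahn \<Rightarrow> 'a hahn" where
  "abs_hahn f = (if f < 0 then - f else f)"

definition sgn_hahn :: "'a hahn \<Rightarrow> 'a hahn" where
  "sgn_hahn f = (if f = 0 then 0 else if 0 < f then 1 else - 1)"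

instance
proof
  fix f g h :: "'a hahn"
  have anti: False if "hpos (g - f)" "hpos (f - g)" for f g :: "'a hahn"
    using hpos_add[OF that] by simp
  show "f < g \<longleftrightarrow> f \<le> g \<and> \<not> g \<le> f"
    using anti[of f g] by (auto simp: less_hahn_def less_eq_hahn_def)
  show "f \<le> f" by (simp add: less_eq_hahn_def)
  show "f \<le> h" if "f \<le> g" "g \<le> h"
    using that hpos_add[of "g - f" "h - g"] by (auto simp: less_eq_hahn_def)
  show "f = g" if "f \<le> g" "g \<le> f"
    using that anti[of f g] by (auto simp: less_eq_hahn_def)
  show "f \<le> g \<or> g \<le> f"
    using hpos_cases[of "g - f"] by (auto simp: less_eq_hahn_def)
  show "h + f \<le> h + g" if "f \<le> g"
    using that by (auto simp: less_eq_hahn_def)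
  show "h * f < h * g" if "f < g" "0 < h"
    using that hpos_mult[of h "g - f"] by (simp add: less_hahn_def right_diff_distrib)
qed (simp_all add: abs_hahn_def sgn_hahn_def)

end

instance hahn :: (linordered_field) linordered_field ..

subsection \<open>Coefficientwise maps and real series\<close>

text \<open>Applied below only to maps with \<open>h 0 = 0\<close>; the case distinction makes \<open>hmap\<close> total.\<close>

lift_definition hmap :: "('a::zero \<Rightarrow> 'b::zero) \<Rightarrow> 'a hahn \<Rightarrow> 'b hahn" is
  "\<lambda>h f q. if f q = 0 then 0 else h (f q)"
  subgoal for h f by (rule well_ordered_subset[of "{q. f q \<noteq> 0}"]) auto
  done

lemma hcoeff_hmap: "h 0 = 0 \<Longrightarrow> hcoeff (hmap h f) q = h (hcoeff f q)"
  by transfer simp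

definition hreal :: "real hahn \<Rightarrow> complex hahn" where
  "hreal = hmap complex_of_real"

text \<open>The order of \<open>\<real>((\<hbar>\<^sup>\<rat>))\<close> inside \<open>\<complex>((\<hbar>\<^sup>\<rat>))\<close>; both sides are asserted to be real.\<close>

definition hle :: "complex hahn \<Rightarrow> complex hahn \<Rightarrow> bool" where
  "hle z w \<longleftrightarrow> (\<exists>a b. z = hreal a \<and> w = hreal b \<and> a \<le> b)"

definition hbar :: "complex hahn" where
  "hbar = hmonom 1 1"

definition hii :: "complex hahn" where
  "hii = hmonom 0 \<i>"

definition hcnj :: "('m \<Rightarrow> complex) hahn \<Rightarrow> ('m \<Rightarrow> complex) hahn" where
  "hcnj = hmap (\<lambda>f x. cnj (f x))"

text \<open>The action of \<open>\<complex>((\<hbar>\<^sup>\<rat>))\<close> on series of functions: scalars become series of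
  constant functions, and the product is the one induced by the pointwise product.\<close>

definition hscale :: "complex hahn \<Rightarrow> ('m \<Rightarrow> complex) hahn \<Rightarrow> ('m \<Rightarrow> complex) hahn" where
  "hscale c F = hmap (\<lambda>z _. z) c * F"


section \<open>Smooth manifolds\<close>

text \<open>On an open set \<open>S\<close>: all iterated directional derivatives exist and are continuous.\<close>

primrec Ck_on :: "nat \<Rightarrow> 'a::real_normed_vector set \<Rightarrow> ('a \<Rightarrow> 'b::real_normed_vector) \<Rightarrow> bool" where
  "Ck_on 0 S f \<longleftrightarrow> continuous_on S f"
| "Ck_on (Suc k) S f \<longleftrightarrow>
     (\<forall>x\<in>S. f differentiable (at x)) \<and> (\<forall>v. Ck_on k S (\<lambda>x. frechet_derivative f (at x) v))"

definition smooth_on :: "'a::real_normed_vector set \<Rightarrow> ('a \<Rightarrow> 'b::real_normed_vector) \<Rightarrow> bool" where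
  "smooth_on S f \<longleftrightarrow> (\<forall>k. Ck_on k S f)"

text \<open>The manifold is the whole type \<open>'m\<close>; Hausdorffness and second countability are sort
  constraints. The model space is a finite-dimensional normed space instead of a
  \<open>euclidean_space\<close>, because the latter class excludes dimension \<open>0\<close>.\<close>

type_synonym ('m, 'e) chart = "'m set \<times> ('m \<Rightarrow> 'e)"

abbreviation chart_inv :: "('m, 'e) chart \<Rightarrow> 'e \<Rightarrow> 'm" where
  "chart_inv c \<equiv> inv_into (fst c) (snd c)"

definition smooth_atlas ::
  "('m::{t2_space,second_countable_topology}, 'e::real_normed_vector) chart set \<Rightarrow> bool" where
  "smooth_atlas A \<longleftrightarrow>
     (\<exists>B::'e set. finite B \<and> span B = UNIV) \<and>
     (\<Union>(U, \<phi>)\<in>A. U) = UNIV \<and>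
     (\<forall>(U, \<phi>)\<in>A. open U \<and> open (\<phi> ` U) \<and> homeomorphism U (\<phi> ` U) \<phi> (inv_into U \<phi>)) \<and>
     (\<forall>(U, \<phi>)\<in>A. \<forall>(V, \<psi>)\<in>A. smooth_on (\<phi> ` (U \<inter> V)) (\<psi> \<circ> inv_into U \<phi>))"

definition Cinf ::
  "('m, 'e::real_normed_vector) chart set \<Rightarrow> ('m \<Rightarrow> 'b::real_normed_vector) set" where
  "Cinf A = {f. \<forall>(U, \<phi>)\<in>A. smooth_on (\<phi> ` U) (f \<circ> inv_into U \<phi>)}"

text \<open>\<open>C\<^sup>\<infinity>(M)((\<hbar>\<^sup>\<rat>))\<close>.\<close>

definition Cinf_series ::
  "('m, 'e::real_normed_vector) chart set \<Rightarrow> ('m \<Rightarrow> complex) hahn set" where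
  "Cinf_series A = {F. \<forall>q. hcoeff F q \<in> Cinf A}"

text \<open>Tangent vectors are derivations of the real smooth functions; the value \<open>0\<close> on other
  functions makes the representation unique.\<close>

type_synonym 'm tangent = "('m \<Rightarrow> real) \<Rightarrow> real"

definition tangent_space ::
  "('m, 'e::real_normed_vector) chart set \<Rightarrow> 'm \<Rightarrow> 'm tangent set" where
  "tangent_space A p = {D.
     (\<forall>f\<in>Cinf A. \<forall>g\<in>Cinf A. D (\<lambda>x. f x + g x) = D f + D g) \<and>
     (\<forall>c. \<forall>f\<in>Cinf A. D (\<lambda>x. c * f x) = c * D f) \<and>
     (\<forall>f\<in>Cinf A. \<forall>g\<in>Cinf A. D (\<lambda>x. f x * g x) = f p * D g + D f * g p) \<and>
     (\<forall>f. f \<notin> Cinf A \<longrightarrow> D f = 0)}"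

text \<open>The coordinate tangent vector \<open>\<partial>\<^sub>v\<close> at the point with coordinates \<open>x\<close>.\<close>

definition coord_tangent ::
  "('m, 'e::real_normed_vector) chart set \<Rightarrow> ('m, 'e) chart \<Rightarrow> 'e \<Rightarrow> 'e \<Rightarrow> 'm tangent" where
  "coord_tangent A c x v f =
     (if f \<in> Cinf A then frechet_derivative (f \<circ> chart_inv c) (at x) v else 0)"


section \<open>Symplectic forms and Poisson brackets\<close>

type_synonym 'm two_form = "'m \<Rightarrow> 'm tangent \<Rightarrow> 'm tangent \<Rightarrow> real"

definition form_in_chart ::
  "('m, 'e::real_normed_vector) chart set \<Rightarrow> 'm two_form \<Rightarrow> ('m, 'e) chart \<Rightarrow> 'e \<Rightarrow> 'e \<Rightarrow> 'e \<Rightarrow> real" where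
  "form_in_chart A \<omega> c x u v =
     \<omega> (chart_inv c x) (coord_tangent A c x u) (coord_tangent A c x v)"

definition smooth_two_form ::
  "('m, 'e::real_normed_vector) chart set \<Rightarrow> 'm two_form \<Rightarrow> bool" where
  "smooth_two_form A \<omega> \<longleftrightarrow>
     (\<forall>p. \<forall>D\<in>tangent_space A p. \<forall>D'\<in>tangent_space A p. \<forall>E\<in>tangent_space A p. \<forall>a b.
        \<omega> p (\<lambda>f. a * D f + b * D' f) E = a * \<omega> p D E + b * \<omega> p D' E) \<and>
     (\<forall>p. \<forall>D\<in>tangent_space A p. \<forall>E\<in>tangent_space A p. \<omega> p D E = - \<omega> p E D) \<and>
     (\<forall>c\<in>A. \<forall>u v. smooth_on (snd c ` fst c) (\<lambda>x. form_in_chart A \<omega> c x u v))"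

definition closed_two_form ::
  "('m, 'e::real_normed_vector) chart set \<Rightarrow> 'm two_form \<Rightarrow> bool" where
  "closed_two_form A \<omega> \<longleftrightarrow> (\<forall>c\<in>A. \<forall>x\<in>snd c ` fst c. \<forall>u v w.
     frechet_derivative (\<lambda>y. form_in_chart A \<omega> c y v w) (at x) u +
     frechet_derivative (\<lambda>y. form_in_chart A \<omega> c y w u) (at x) v +
     frechet_derivative (\<lambda>y. form_in_chart A \<omega> c y u v) (at x) w = 0)"

definition nondegenerate_two_form ::
  "('m, 'e::real_normed_vector) chart set \<Rightarrow> 'm two_form \<Rightarrow> bool" where
  "nondegenerate_two_form A \<omega> \<longleftrightarrow> (\<forall>p. \<forall>D\<in>tangent_space A p.
     (\<forall>E\<in>tangent_space A p. \<omega> p D E = 0) \<longrightarrow> D = (\<lambda>_. 0))"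

definition symplectic_manifold ::
  "('m::{t2_space,second_countable_topology}, 'e::real_normed_vector) chart set
     \<Rightarrow> 'm two_form \<Rightarrow> bool" where
  "symplectic_manifold A \<omega> \<longleftrightarrow>
     smooth_atlas A \<and> smooth_two_form A \<omega> \<and> closed_two_form A \<omega> \<and> nondegenerate_two_form A \<omega>"

text \<open>The value at \<open>p\<close> of the Hamiltonian vector field \<open>X\<^sub>f\<close>, \<open>\<omega>(X\<^sub>f, \<cdot>) = df\<close>. The bracket
  \<open>\<omega>(X\<^sub>f, X\<^sub>g)\<close> is the same for the convention \<open>\<omega>(X\<^sub>f, \<cdot>) = - df\<close>; for
  \<open>\<omega> = dq \<and> dp\<close> it gives \<open>{q, p} = 1\<close>.\<close>

definition hamiltonian ::
  "('m, 'e::real_normed_vector) chart set \<Rightarrow> 'm two_form \<Rightarrow> ('m \<Rightarrow> real) \<Rightarrow> 'm \<Rightarrow> 'm tangent" where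
  "hamiltonian A \<omega> f p =
     (THE D. D \<in> tangent_space A p \<and> (\<forall>E\<in>tangent_space A p. \<omega> p D E = E f))"

definition poisson_real ::
  "('m, 'e::real_normed_vector) chart set \<Rightarrow> 'm two_form
     \<Rightarrow> ('m \<Rightarrow> real) \<Rightarrow> ('m \<Rightarrow> real) \<Rightarrow> 'm \<Rightarrow> real" where
  "poisson_real A \<omega> f g p = \<omega> p (hamiltonian A \<omega> f p) (hamiltonian A \<omega> g p)"

text \<open>The complex bilinear extension.\<close>

definition poisson ::
  "('m, 'e::real_normed_vector) chart set \<Rightarrow> 'm two_form
     \<Rightarrow> ('m \<Rightarrow> complex) \<Rightarrow> ('m \<Rightarrow> complex) \<Rightarrow> 'm \<Rightarrow> complex" where
  "poisson A \<omega> f g p = Complex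
     (poisson_real A \<omega> (Re \<circ> f) (Re \<circ> g) p - poisson_real A \<omega> (Im \<circ> f) (Im \<circ> g) p)
     (poisson_real A \<omega> (Re \<circ> f) (Im \<circ> g) p + poisson_real A \<omega> (Im \<circ> f) (Re \<circ> g) p)"


section \<open>Star products and states\<close>

primrec dir_derivs :: "'e::real_normed_vector list \<Rightarrow> ('e \<Rightarrow> complex) \<Rightarrow> 'e \<Rightarrow> complex" where
  "dir_derivs [] f = f"
| "dir_derivs (v # vs) f = (\<lambda>x. frechet_derivative (dir_derivs vs f) (at x) v)"

text \<open>Bidifferential operators: near every point of a chart, a finite sum of smooth coefficients
  times iterated partial derivatives of the two arguments. A multi-index is encoded by a list of
  vectors (repetitions allowed); allowing all vectors instead of those of a fixed basis
  gives the same operators. The order may vary from point to point, which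
  includes the operators of globally bounded order.\<close>

definition bidifferential ::
  "('m::topological_space, 'e::real_normed_vector) chart set
     \<Rightarrow> (('m \<Rightarrow> complex) \<Rightarrow> ('m \<Rightarrow> complex) \<Rightarrow> 'm \<Rightarrow> complex) \<Rightarrow> bool" where
  "bidifferential A C \<longleftrightarrow>
     (\<forall>f\<in>Cinf A. \<forall>g\<in>Cinf A. C f g \<in> Cinf A) \<and>
     (\<forall>(U, \<phi>)\<in>A. \<forall>p\<in>U. \<exists>V L a.
        open V \<and> p \<in> V \<and> V \<subseteq> U \<and> finite L \<and>
        (\<forall>vs\<in>L. \<forall>ws\<in>L. smooth_on (\<phi> ` V) (a vs ws)) \<and>
        (\<forall>f\<in>Cinf A. \<forall>g\<in>Cinf A. \<forall>x\<in>V.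
           C f g x = (\<Sum>vs\<in>L. \<Sum>ws\<in>L. a vs ws (\<phi> x) *
             dir_derivs vs (f \<circ> inv_into U \<phi>) (\<phi> x) * dir_derivs ws (g \<circ> inv_into U \<phi>) (\<phi> x))))"

text \<open>Pairs \<open>(k, a)\<close> such that \<open>C\<^sub>k(F\<^sub>a, G\<^sub>b)\<close> with \<open>k + a + b = q\<close> contributes to the
  coefficient of \<open>F * G\<close> at \<open>q\<close>.\<close>

definition star_index :: "'a::zero hahn \<Rightarrow> 'a hahn \<Rightarrow> rat \<Rightarrow> (nat \<times> rat) set" where
  "star_index F G q = {(k, a). a \<in> hsupp F \<and> q - of_nat k - a \<in> hsupp G}"

lemma finite_star_index: "finite (star_index F G q)"
proof (cases "F = 0 \<or> G = 0")
  case True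
  then show ?thesis by (auto simp: star_index_def)
next
  case False
  have le: "hval H \<le> a" if "a \<in> hsupp H" for H :: "'a hahn" and a
    using that hcoeff_less_hval[of H a] by (cases "H = 0") (auto simp: in_hsupp not_less[symmetric])
  define N where "N = nat \<lceil>q - hval F - hval G\<rceil>"
  have "star_index F G q \<subseteq> (SIGMA k:{..N}. {a \<in> hsupp F. q - of_nat k - a \<in> hsupp G})"
  proof
    fix x assume "x \<in> star_index F G q"
    then obtain k a where x: "x = (k, a)" "a \<in> hsupp F" "q - of_nat k - a \<in> hsupp G"
      by (auto simp: star_index_def)
    have "of_nat k \<le> q - hval F - hval G" using le[OF x(2)] le[OF x(3)] by linarith
    then have "k \<le> N" unfolding N_def by linarith
    then show "x \<in> (SIGMA k:{..N}. {a \<in> hsupp F. q - of_nat k - a \<in> hsupp G})" using x by simp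
  qed
  moreover have "finite (SIGMA k:{..N}. {a \<in> hsupp F. q - of_nat k - a \<in> hsupp G})"
    by (intro finite_SigmaI finite_antidiagonal) simp_all
  ultimately show ?thesis by (rule finite_subset)
qed

definition star_product ::
  "('m::topological_space, 'e::real_normed_vector) chart set \<Rightarrow> 'm two_form
     \<Rightarrow> (('m \<Rightarrow> complex) hahn \<Rightarrow> ('m \<Rightarrow> complex) hahn \<Rightarrow> ('m \<Rightarrow> complex) hahn) \<Rightarrow> bool" where
  "star_product A \<omega> star \<longleftrightarrow>
     (\<forall>F\<in>Cinf_series A. \<forall>G\<in>Cinf_series A. \<forall>H\<in>Cinf_series A.
        star (star F G) H = star F (star G H)) \<and>
     (\<forall>F\<in>Cinf_series A. \<forall>G\<in>Cinf_series A. \<forall>H\<in>Cinf_series A. \<forall>c.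
        star (hscale c F + G) H = hscale c (star F H) + star G H \<and>
        star H (hscale c F + G) = hscale c (star H F) + star H G) \<and>
     (\<exists>C :: nat \<Rightarrow> ('m \<Rightarrow> complex) \<Rightarrow> ('m \<Rightarrow> complex) \<Rightarrow> 'm \<Rightarrow> complex.
        (\<forall>k. bidifferential A (C k)) \<and>
        (\<forall>F\<in>Cinf_series A. \<forall>G\<in>Cinf_series A. \<forall>q.
           hcoeff (star F G) q =
             (\<Sum>(k, a)\<in>star_index F G q. C k (hcoeff F a) (hcoeff G (q - of_nat k - a)))) \<and>
        (\<forall>f\<in>Cinf A. \<forall>g\<in>Cinf A. C 0 f g = f * g) \<and>
        (\<forall>k\<ge>1. \<forall>f\<in>Cinf A. C k 1 f = 0 \<and> C k f 1 = 0) \<and>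
        (\<forall>f\<in>Cinf A. \<forall>g\<in>Cinf A. \<forall>p. C 1 f g p - C 1 g f p = \<i> * poisson A \<omega> f g p))"

definition star_state ::
  "('m, 'e::real_normed_vector) chart set
     \<Rightarrow> (('m \<Rightarrow> complex) hahn \<Rightarrow> ('m \<Rightarrow> complex) hahn \<Rightarrow> ('m \<Rightarrow> complex) hahn)
     \<Rightarrow> (('m \<Rightarrow> complex) hahn \<Rightarrow> complex hahn) \<Rightarrow> bool" where
  "star_state A star \<rho> \<longleftrightarrow>
     (\<forall>F\<in>Cinf_series A. \<forall>G\<in>Cinf_series A. \<forall>c. \<rho> (hscale c F + G) = c * \<rho> F + \<rho> G) \<and>
     (\<forall>F\<in>Cinf_series A. hle 0 (\<rho> (star (hcnj F) F))) \<and>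
     \<rho> 1 = 1"

definition star_bracket ::
  "(('m \<Rightarrow> complex) hahn \<Rightarrow> ('m \<Rightarrow> complex) hahn \<Rightarrow> ('m \<Rightarrow> complex) hahn)
     \<Rightarrow> ('m \<Rightarrow> complex) hahn \<Rightarrow> ('m \<Rightarrow> complex) hahn \<Rightarrow> ('m \<Rightarrow> complex) hahn" where
  "star_bracket star X Y = hscale (1 / (hii * hbar)) (star X Y - star Y X)"

definition variance ::
  "(('m \<Rightarrow> complex) hahn \<Rightarrow> ('m \<Rightarrow> complex) hahn \<Rightarrow> ('m \<Rightarrow> complex) hahn)
     \<Rightarrow> (('m \<Rightarrow> complex) hahn \<Rightarrow> complex hahn) \<Rightarrow> ('m \<Rightarrow> complex) hahn \<Rightarrow> complex hahn" where
  "variance star \<rho> X = \<rho> (star X X) - (\<rho> X)\<^sup>2"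

end

theory Submission
  imports Defs
begin

text \<open>The complex covariance matrix \<open>\<rho>((X\<^sub>j - \<rho>(X\<^sub>j)) * (X\<^sub>k - \<rho>(X\<^sub>k)))\<close> is \<open>S + iM\<close> with real
  \<open>S\<close> symmetric and real \<open>M\<close> alternating. Centering changes no commutator, so \<open>M\<close> is the matrix
  \<open>\<hbar>/2 \<rho>({X\<^sub>j, X\<^sub>k}\<^sub>*)\<close> of the theorem, and the diagonal of \<open>S\<close> consists of the variances.
  Positivity of \<open>\<rho>\<close> on \<open>u + iv\<close>, for real linear combinations \<open>u\<close>, \<open>v\<close> of the centered observables,
  says exactly \<open>2 u\<^sup>T M v \<le> u\<^sup>T S u + v\<^sup>T S v\<close>. So the claim is a statement about matrices over an
  ordered field: a matrix dominated in this sense by a positive semidefinite \<open>S\<close> has determinant at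
  most \<open>\<Prod>\<^sub>j S\<^sub>j\<^sub>j\<close> (\<open>det_dominated_le\<close>).

  Robertson's argument for real numbers diagonalizes \<open>S\<close> and \<open>M\<close> simultaneously, which needs
  square roots of scalars. The argument here uses field operations only. If \<open>S\<close> is singular, then so is \<open>M\<close>. Otherwise
  \<open>G = M S\<^sup>-\<^sup>1 M\<^sup>T\<close> satisfies \<open>0 \<le> G \<le> S\<close> as a quadratic form, and two applications of Hadamard's
  inequality (\<open>hadamard_inequality\<close>, proved by induction with Schur complements) give
  \<open>(det M)\<^sup>2 = det G det S \<le> (\<Prod>\<^sub>j S\<^sub>j\<^sub>j)\<^sup>2\<close>.

  The link between the two parts is the form \<open>\<rho>(F * G)\<close>. It is bilinear because sums, scalar multiples
  and products of series of smooth functions are again such series, where \<open>\<rho>\<close> is linear; the unit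
  law \<open>1 * F = F = F * 1\<close> makes \<open>\<rho>(F)\<close> one of its values, which is what centering uses. The reality of \<open>\<rho>(X\<^sub>j)\<close>, and of \<open>S\<close> and \<open>M\<close>, follows from
  positivity by polarization.\<close>


section \<open>Positive semidefinite matrices over an ordered field\<close>

definition psd :: "nat \<Rightarrow> 'a::linordered_field mat \<Rightarrow> bool" where
  "psd n M \<longleftrightarrow> M \<in> carrier_mat n n \<and> M\<^sup>T = M \<and> (\<forall>v\<in>carrier_vec n. 0 \<le> v \<bullet> (M *\<^sub>v v))"

lemma form_eq_sum:
  assumes "M \<in> carrier_mat n n" "u \<in> carrier_vec n" "v \<in> carrier_vec n"
  shows "u \<bullet> (M *\<^sub>v v) = (\<Sum>i<n. \<Sum>j<n. u $ i * M $$ (i, j) * v $ j)"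
  using assms
  by (auto simp: scalar_prod_def sum_distrib_left mult.assoc atLeast0LessThan intro!: sum.cong)

lemma psd_symD: "psd n M \<Longrightarrow> i < n \<Longrightarrow> j < n \<Longrightarrow> M $$ (i, j) = M $$ (j, i)"
  unfolding psd_def by (metis carrier_matD index_transpose_mat(1))

lemma psd_sum_nonneg:
  assumes "psd n M"
  shows "0 \<le> (\<Sum>i<n. \<Sum>j<n. y i * M $$ (i, j) * y j)"
proof -
  have "0 \<le> vec n y \<bullet> (M *\<^sub>v vec n y)" using assms by (auto simp: psd_def)
  also have "\<dots> = (\<Sum>i<n. \<Sum>j<n. y i * M $$ (i, j) * y j)"
    using assms by (subst form_eq_sum[of _ n]) (auto simp: psd_def intro!: sum.cong)
  finally show ?thesis .
qed

definition schur_complement :: "nat \<Rightarrow> 'a::field mat \<Rightarrow> 'a mat" where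
  "schur_complement n M =
     mat n n (\<lambda>(i, j). M $$ (i, j) - M $$ (i, n) * M $$ (n, j) / M $$ (n, n))"

text \<open>One step of Gaussian elimination: \<open>M = L U\<close> with \<open>L\<close> unipotent, where \<open>U\<close> has last row that of
  \<open>M\<close> and the Schur complement above it.\<close>

lemma det_schur_complement:
  fixes M :: "'a::field mat"
  assumes M: "M \<in> carrier_mat (Suc n) (Suc n)" and p: "M $$ (n, n) \<noteq> 0"
  shows "det M = M $$ (n, n) * det (schur_complement n M)"
proof -
  define L where "L = mat (Suc n) (Suc n)
    (\<lambda>(i, j). if i = j then 1 else if j = n then M $$ (i, n) / M $$ (n, n) else 0)"
  define U where "U = mat (Suc n) (Suc n)
    (\<lambda>(i, j). if i = n then M $$ (n, j) else if j = n then 0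
       else schur_complement n M $$ (i, j))"
  have LU: "L \<in> carrier_mat (Suc n) (Suc n)" "U \<in> carrier_mat (Suc n) (Suc n)"
    by (simp_all add: L_def U_def)
  have "M = L * U"
  proof (rule eq_matI)
    fix i j assume "i < dim_row (L * U)" "j < dim_col (L * U)"
    then have ij: "i < Suc n" "j < Suc n" using LU by auto
    have "(L * U) $$ (i, j) = (\<Sum>k<Suc n. L $$ (i, k) * U $$ (k, j))"
      using ij LU by (simp add: scalar_prod_def atLeast0LessThan)
    also have "\<dots> = (\<Sum>k<n. L $$ (i, k) * U $$ (k, j)) + L $$ (i, n) * U $$ (n, j)" by simp
    also have "(\<Sum>k<n. L $$ (i, k) * U $$ (k, j)) = (if i < n then U $$ (i, j) else 0)"
    proof -
      have "(\<Sum>k<n. L $$ (i, k) * U $$ (k, j)) = (\<Sum>k<n. if k = i then U $$ (i, j) else 0)"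
        using ij by (intro sum.cong) (auto simp: L_def)
      then show ?thesis by simp
    qed
    also have "\<dots> + L $$ (i, n) * U $$ (n, j) = M $$ (i, j)"
      using ij p by (auto simp: L_def U_def schur_complement_def less_Suc_eq)
    finally show "M $$ (i, j) = (L * U) $$ (i, j)" by simp
  qed (use M LU in auto)
  moreover have "det L = 1"
  proof -
    have "det L = prod_list (diag_mat L)"
      by (rule det_upper_triangular[OF _ LU(1)]) (auto simp: L_def)
    also have "diag_mat L = map (\<lambda>_. 1) [0..<Suc n]"
      unfolding diag_mat_def by (rule map_cong) (auto simp: L_def)
    finally show ?thesis by (simp add: map_replicate_const)
  qed
  moreover have "det U = M $$ (n, n) * det (schur_complement n M)"
  proof -
    have "det U = (\<Sum>i<Suc n. U $$ (i, n) * cofactor U i n)"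
      by (rule laplace_expansion_column[OF LU(2)]) simp
    also have "\<dots> = M $$ (n, n) * cofactor U n n"
      by (simp add: U_def)
    also have "mat_delete U n n = schur_complement n M"
      by (rule eq_matI) (auto simp: mat_delete_def U_def schur_complement_def)
    then have "cofactor U n n = det (schur_complement n M)"
      by (simp add: cofactor_def power_add[symmetric])
    finally show ?thesis .
  qed
  ultimately show ?thesis using det_mult[OF LU] by simp
qed

text \<open>The form on the vector with first coordinates \<open>y\<close> and last coordinate \<open>t\<close>, as a quadratic
  polynomial in \<open>t\<close>: the minimum over \<open>t\<close> yields the Schur complement, and a vanishing leading
  coefficient forces the linear coefficient to vanish.\<close>

lemma psd_split_last:
  assumes M: "psd (Suc n) M"
  shows "0 \<le> (\<Sum>i<n. \<Sum>j<n. y i * M $$ (i, j) * y j) +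
    2 * t * (\<Sum>i<n. M $$ (i, n) * y i) + M $$ (n, n) * t\<^sup>2"
proof -
  define z where "z = y(n := t)"
  have sym: "M $$ (n, i) = M $$ (i, n)" if "i < n" for i
    using psd_symD[OF M] that by simp
  have "0 \<le> (\<Sum>i<Suc n. \<Sum>j<Suc n. z i * M $$ (i, j) * z j)"
    by (rule psd_sum_nonneg[OF M])
  also have "\<dots> = (\<Sum>i<n. \<Sum>j<n. y i * M $$ (i, j) * y j) + (\<Sum>i<n. y i * M $$ (i, n) * t)
      + ((\<Sum>j<n. t * M $$ (n, j) * y j) + t * M $$ (n, n) * t)"
    by (simp add: z_def sum.distrib)
  also have "(\<Sum>i<n. y i * M $$ (i, n) * t) = t * (\<Sum>i<n. M $$ (i, n) * y i)"
    by (simp add: sum_distrib_left mult_ac)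
  also have "(\<Sum>j<n. t * M $$ (n, j) * y j) = t * (\<Sum>i<n. M $$ (i, n) * y i)"
    by (simp add: sum_distrib_left mult_ac sym)
  finally show ?thesis by (simp add: power2_eq_square algebra_simps)
qed

lemma sum_delta_form:
  fixes F :: "nat \<Rightarrow> nat \<Rightarrow> 'a::comm_ring_1"
  assumes "k < n"
  shows "(\<Sum>i<n. \<Sum>j<n. (if i = k then 1 else 0) * F i j * (if j = k then 1 else 0)) = F k k"
proof -
  have "(\<Sum>j<n. (if i = k then 1 else 0) * F i j * (if j = k then 1 else 0)) =
      (if i = k then F k k else 0)" for i
  proof -
    have "(\<Sum>j<n. (if i = k then 1 else 0) * F i j * (if j = k then 1 else 0)) =
        (\<Sum>j<n. if j = k then (if i = k then F k k else 0) else 0)"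
      by (rule sum.cong) auto
    then show ?thesis using assms by simp
  qed
  then show ?thesis using assms by simp
qed

lemma psd_diag_nonneg:
  assumes "psd n M" "k < n"
  shows "0 \<le> M $$ (k, k)"
proof -
  have "0 \<le> (\<Sum>i<n. \<Sum>j<n. (if i = k then 1 else 0) * M $$ (i, j) * (if j = k then 1 else 0))"
    by (rule psd_sum_nonneg[OF assms(1)])
  also have "\<dots> = M $$ (k, k)" by (rule sum_delta_form[OF assms(2)])
  finally show ?thesis .
qed

lemma psd_schur_complement:
  assumes M: "psd (Suc n) M" and p: "M $$ (n, n) \<noteq> 0"
  shows "psd n (schur_complement n M)"
proof -
  have sym: "M $$ (i, j) = M $$ (j, i)" if "i < Suc n" "j < Suc n" for i j
    using psd_symD[OF M] that by simp
  have "0 \<le> v \<bullet> (schur_complement n M *\<^sub>v v)" if v: "v \<in> carrier_vec n" for v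
  proof -
    have sym': "M $$ (n, j) = M $$ (j, n)" if "j < n" for j using sym that by simp
    define b where "b = (\<Sum>i<n. M $$ (i, n) * v $ i)"
    \<comment> \<open>The value of the last coordinate that minimizes the form for given first coordinates.\<close>
    define t where "t = - b / M $$ (n, n)"
    have "0 \<le> (\<Sum>i<n. \<Sum>j<n. v $ i * M $$ (i, j) * v $ j) + (2 * t * b + M $$ (n, n) * t\<^sup>2)"
      unfolding b_def using psd_split_last[OF M, of "\<lambda>i. v $ i" t] by (simp add: add.assoc)
    also have "2 * t * b + M $$ (n, n) * t\<^sup>2 = - (b * b / M $$ (n, n))"
      using p by (simp add: t_def power2_eq_square)
    also have "b * b / M $$ (n, n) =
        (\<Sum>i<n. \<Sum>j<n. v $ i * (M $$ (i, n) * M $$ (n, j) / M $$ (n, n)) * v $ j)"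
      unfolding b_def sum_product sum_divide_distrib
      by (intro sum.cong) (simp_all add: sym' mult_ac)
    also have "(\<Sum>i<n. \<Sum>j<n. v $ i * M $$ (i, j) * v $ j) + - \<dots> =
        v \<bullet> (schur_complement n M *\<^sub>v v)"
      using v by (subst form_eq_sum[of _ n])
        (auto simp: schur_complement_def sum_subtractf[symmetric] algebra_simps intro!: sum.cong)
    finally show ?thesis .
  qed
  moreover have "(schur_complement n M)\<^sup>T = schur_complement n M"
    by (rule eq_matI) (auto simp: schur_complement_def sym mult.commute)
  ultimately show ?thesis by (simp add: psd_def schur_complement_def)
qed

lemma psd_zero_pivot:
  assumes M: "psd (Suc n) M" and p: "M $$ (n, n) = 0" and k: "k < n"
  shows "M $$ (k, n) = 0"
proof (rule ccontr)
  assume nz: "M $$ (k, n) \<noteq> 0"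
  \<comment> \<open>With a zero pivot the form on \<open>e\<^sub>k + t e\<^sub>n\<close> is affine in \<open>t\<close>; this \<open>t\<close> gives it the value \<open>-1\<close>.\<close>
  define t where "t = - (M $$ (k, k) + 1) / (2 * M $$ (k, n))"
  have "0 \<le> (\<Sum>i<n. \<Sum>j<n. (if i = k then 1 else 0) * M $$ (i, j) * (if j = k then 1 else 0)) +
    2 * t * (\<Sum>i<n. M $$ (i, n) * (if i = k then 1 else 0)) + M $$ (n, n) * t\<^sup>2"
    by (rule psd_split_last[OF M])
  also have "(\<Sum>i<n. M $$ (i, n) * (if i = k then 1 else 0)) = (\<Sum>i<n. if i = k then M $$ (k, n) else 0)"
    by (rule sum.cong) auto
  also have "\<dots> = M $$ (k, n)" using k by simp
  also have "(\<Sum>i<n. \<Sum>j<n. (if i = k then 1 else 0) * M $$ (i, j) * (if j = k then 1 else 0)) = M $$ (k, k)"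
    by (rule sum_delta_form[OF k])
  also have "M $$ (k, k) + 2 * t * M $$ (k, n) + M $$ (n, n) * t\<^sup>2 = M $$ (k, k) + 2 * t * M $$ (k, n)"
    using p by simp
  also have "\<dots> = - 1" using nz by (simp add: t_def field_simps)
  finally show False by simp
qed

text \<open>Passing to the Schur complement splits off the last diagonal entry as a factor of the
  determinant and can only decrease the other diagonal entries.\<close>

lemma hadamard_inequality:
  "psd n M \<Longrightarrow> 0 \<le> det M \<and> det M \<le> (\<Prod>i<n. M $$ (i, i))"
proof (induction n arbitrary: M)
  case 0
  then show ?case by (simp add: psd_def)
next
  case (Suc n)
  have C: "M \<in> carrier_mat (Suc n) (Suc n)" using Suc.prems by (simp add: psd_def)
  have diag: "0 \<le> M $$ (i, i)" if "i < Suc n" for i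
    using psd_diag_nonneg[OF Suc.prems that] .
  show ?case
  proof (cases "M $$ (n, n) = 0")
    case True
    have "M $$ (i, n) = 0" if "i < Suc n" for i
      using psd_zero_pivot[OF Suc.prems True] True that by (cases "i = n") auto
    then have "det M = 0" by (subst laplace_expansion_column[OF C, of n]) simp_all
    then show ?thesis using True by simp
  next
    case False
    define N where "N = schur_complement n M"
    have pos: "0 < M $$ (n, n)" using False diag[of n] by simp
    have psdN: "psd n N" unfolding N_def by (rule psd_schur_complement[OF Suc.prems False])
    note IH = Suc.IH[OF psdN]
    have "(\<Prod>i<n. N $$ (i, i)) \<le> (\<Prod>i<n. M $$ (i, i))"
    proof (rule prod_mono)
      fix i assume "i \<in> {..<n}"
      then have i: "i < n" by simp
      have "N $$ (i, i) = M $$ (i, i) - (M $$ (i, n))\<^sup>2 / M $$ (n, n)"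
        using i psd_symD[OF Suc.prems, of n i]
        by (simp add: N_def schur_complement_def power2_eq_square)
      moreover have "0 \<le> (M $$ (i, n))\<^sup>2 / M $$ (n, n)" using pos by simp
      ultimately show "0 \<le> N $$ (i, i) \<and> N $$ (i, i) \<le> M $$ (i, i)"
        using psd_diag_nonneg[OF psdN i] by simp
    qed
    then have "det N \<le> (\<Prod>i<n. M $$ (i, i))" using IH by simp
    then have "M $$ (n, n) * det N \<le> M $$ (n, n) * (\<Prod>i<n. M $$ (i, i))"
      using pos by (intro mult_left_mono) simp_all
    then show ?thesis
      using IH pos det_schur_complement[OF C False] by (simp add: N_def mult.commute)
  qed
qed

lemma invertible_mat_obtain:
  fixes S :: "'a::field mat"
  assumes "S \<in> carrier_mat n n" "det S \<noteq> 0"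
  obtains T where "T \<in> carrier_mat n n" "T * S = 1\<^sub>m n" "S * T = 1\<^sub>m n"
  using det_non_zero_imp_unit[OF assms, of "()"]
  by (auto simp: Units_def ring_mat_def)

lemma diag_eq_form:
  fixes M :: "'a::comm_ring_1 mat"
  assumes "M \<in> carrier_mat n n" "k < n"
  shows "M $$ (k, k) = unit_vec n k \<bullet> (M *\<^sub>v unit_vec n k)"
proof -
  have "unit_vec n k \<bullet> (M *\<^sub>v unit_vec n k) =
      (\<Sum>i<n. \<Sum>j<n. (if i = k then 1 else 0) * M $$ (i, j) * (if j = k then 1 else 0))"
    using assms by (subst form_eq_sum[of _ n]) (auto intro!: sum.cong)
  also have "\<dots> = M $$ (k, k)" by (rule sum_delta_form[OF assms(2)])
  finally show ?thesis by simp
qed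

text \<open>The ordered-field form of Robertson's determinant inequality. The comparison form
  \<open>G = M S\<^sup>-\<^sup>1 M\<^sup>T\<close> has the value \<open>w\<^sup>T S w = u\<^sup>T M w\<close> at \<open>u\<close>, where \<open>w = S\<^sup>-\<^sup>1 M\<^sup>T u\<close>; the hypothesis for \<open>u\<close> and
  \<open>w\<close> therefore reads \<open>2 G(u) \<le> S(u) + G(u)\<close>.\<close>

lemma det_dominated_le:
  fixes S M :: "'a::linordered_field mat"
  assumes S: "psd n S" and M: "M \<in> carrier_mat n n"
    and dom: "\<And>u v. u \<in> carrier_vec n \<Longrightarrow> v \<in> carrier_vec n \<Longrightarrow>
      2 * (u \<bullet> (M *\<^sub>v v)) \<le> u \<bullet> (S *\<^sub>v u) + v \<bullet> (S *\<^sub>v v)"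
  shows "det M \<le> (\<Prod>i<n. S $$ (i, i))"
proof -
  define P where "P = (\<Prod>i<n. S $$ (i, i))"
  have Sc: "S \<in> carrier_mat n n" and St: "S\<^sup>T = S" using S by (auto simp: psd_def)
  have P0: "0 \<le> P" unfolding P_def using psd_diag_nonneg[OF S] by (intro prod_nonneg) simp
  have detS: "0 \<le> det S" "det S \<le> P" using hadamard_inequality[OF S] by (auto simp: P_def)
  show ?thesis
  proof (cases "det S = 0")
    case True
    then obtain v where v: "v \<in> carrier_vec n" "v \<noteq> 0\<^sub>v n" "S *\<^sub>v v = 0\<^sub>v n"
      using det_0_iff_vec_prod_zero[OF Sc] by auto
    define u where "u = M *\<^sub>v v"
    have u: "u \<in> carrier_vec n" unfolding u_def by (rule mult_mat_vec_carrier[OF M v(1)])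
    \<comment> \<open>The kernel vector \<open>v\<close> may be scaled at no cost, so \<open>u\<^sup>T M v\<close> cannot be positive.\<close>
    have bound: "t * (2 * (u \<bullet> u)) \<le> u \<bullet> (S *\<^sub>v u)" for t
    proof -
      have "2 * (u \<bullet> (M *\<^sub>v (t \<cdot>\<^sub>v v))) \<le> u \<bullet> (S *\<^sub>v u) + (t \<cdot>\<^sub>v v) \<bullet> (S *\<^sub>v (t \<cdot>\<^sub>v v))"
        by (rule dom) (use u v in auto)
      also have "S *\<^sub>v (t \<cdot>\<^sub>v v) = 0\<^sub>v n"
        by (rule eq_vecI) (simp_all add: mult_mat_vec[OF Sc v(1)] v(3))
      also have "M *\<^sub>v (t \<cdot>\<^sub>v v) = t \<cdot>\<^sub>v u"
        using v M by (simp add: mult_mat_vec u_def)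
      finally show ?thesis using u v by (simp add: mult_ac)
    qed
    have "u = 0\<^sub>v n"
    proof (rule ccontr)
      assume "u \<noteq> 0\<^sub>v n"
      then obtain i where i: "i < n" "u $ i \<noteq> 0"
        using u by (metis carrier_vecD eq_vecI index_zero_vec)
      have "u \<bullet> u = (\<Sum>i<n. (u $ i)\<^sup>2)"
        using u by (simp add: scalar_prod_def power2_eq_square atLeast0LessThan)
      moreover have "0 < (\<Sum>i<n. (u $ i)\<^sup>2)"
        by (rule sum_pos2[of _ i]) (use i in auto)
      ultimately have pos: "0 < u \<bullet> u" by simp
      have "(u \<bullet> (S *\<^sub>v u) + 1) / (2 * (u \<bullet> u)) * (2 * (u \<bullet> u)) = u \<bullet> (S *\<^sub>v u) + 1"
        using pos by simp
      then show False using bound[of "(u \<bullet> (S *\<^sub>v u) + 1) / (2 * (u \<bullet> u))"] by linarith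
    qed
    then have "det M = 0" using det_0_iff_vec_prod_zero[OF M] v by (auto simp: u_def)
    then show ?thesis using P0 by (simp add: P_def)
  next
    case False
    then obtain T where T: "T \<in> carrier_mat n n" "T * S = 1\<^sub>m n" "S * T = 1\<^sub>m n"
      using invertible_mat_obtain[OF Sc] by blast
    define G where "G = M * T * M\<^sup>T"
    have Mt: "M\<^sup>T \<in> carrier_mat n n" and G: "G \<in> carrier_mat n n" using M T by (auto simp: G_def)
    have "T\<^sup>T * S = 1\<^sub>m n"
      using transpose_mult[OF Sc T(1)] T(3) St by simp
    then have "T\<^sup>T = T"
      using assoc_mult_mat[of "T\<^sup>T" n n S n T n] T Sc by simp
    then have Gt: "G\<^sup>T = G"
      using M T(1) Mt by (simp add: G_def transpose_mult[of _ n n _ n] assoc_mult_mat[of _ n n _ n _ n])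
    have key: "0 \<le> u \<bullet> (G *\<^sub>v u) \<and> u \<bullet> (G *\<^sub>v u) \<le> u \<bullet> (S *\<^sub>v u)" if u: "u \<in> carrier_vec n" for u
    proof -
      define w where "w = T *\<^sub>v (M\<^sup>T *\<^sub>v u)"
      have w: "w \<in> carrier_vec n"
        unfolding w_def by (intro mult_mat_vec_carrier[OF T(1)] mult_mat_vec_carrier[OF Mt u])
      have Gu: "G *\<^sub>v u = M *\<^sub>v w"
        using u M Mt T(1) by (simp add: G_def w_def assoc_mult_mat_vec[of _ n n _ n])
      have Mu: "M\<^sup>T *\<^sub>v u \<in> carrier_vec n" using Mt u by simp
      have Sw: "S *\<^sub>v w = M\<^sup>T *\<^sub>v u"
        unfolding w_def using assoc_mult_mat_vec[OF Sc T(1) Mu] T(3) Mu by simp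
      have "u \<bullet> (M *\<^sub>v w) = (S *\<^sub>v w) \<bullet> w"
        unfolding Sw using transpose_vec_mult_scalar[OF M w u] by simp
      also have "\<dots> = w \<bullet> (S *\<^sub>v w)"
        using w Sc by (intro comm_scalar_prod[of _ n]) auto
      finally have eq: "u \<bullet> (G *\<^sub>v u) = w \<bullet> (S *\<^sub>v w)" "u \<bullet> (M *\<^sub>v w) = w \<bullet> (S *\<^sub>v w)" using Gu by auto
      have "0 \<le> w \<bullet> (S *\<^sub>v w)" using S w by (simp add: psd_def)
      then show ?thesis using dom[OF u w] eq by simp
    qed
    then have psdG: "psd n G" using G Gt by (simp add: psd_def)
    have "(\<Prod>i<n. G $$ (i, i)) \<le> P"
      unfolding P_def
    proof (rule prod_mono)
      fix i assume "i \<in> {..<n}"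
      then show "0 \<le> G $$ (i, i) \<and> G $$ (i, i) \<le> S $$ (i, i)"
        using key[of "unit_vec n i"] by (simp add: diag_eq_form[OF G] diag_eq_form[OF Sc])
    qed
    then have detG: "det G \<le> P" using hadamard_inequality[OF psdG] by simp
    have "det T * det S = 1" using det_mult[OF T(1) Sc] T(2) by simp
    moreover have "det G = det M * det T * det M"
      using M T(1) Mt by (simp add: G_def det_mult[of _ n] det_transpose)
    ultimately have "(det M)\<^sup>2 = det G * det S"
      by (simp add: power2_eq_square mult_ac)
    also have "\<dots> \<le> P * P" using detG detS P0 by (intro mult_mono) auto
    finally have "(det M)\<^sup>2 \<le> P\<^sup>2" by (simp add: power2_eq_square)
    then show ?thesis using P0 power2_le_imp_le by (auto simp: P_def)
  qed
qed

section \<open>Scalars and conjugation of series\<close>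

text \<open>Common source of three homomorphisms: the embedding of the real series, the embedding of
  scalars as constant functions, and conjugation.\<close>

lemma hmap_comm_ring_hom:
  assumes "comm_ring_hom h"
  shows "comm_ring_hom (hmap h)"
proof -
  interpret h: comm_ring_hom h by fact
  have c: "hcoeff (hmap h f) q = h (hcoeff f q)" for f q by (simp add: hcoeff_hmap)
  show ?thesis
  proof
    fix f g
    show "hmap h (f + g) = hmap h f + hmap h g"
      by (rule hahn_eqI) (simp add: c h.hom_add)
    show "hmap h (f * g) = hmap h f * hmap h g"
    proof (rule hahn_eqI)
      fix q
      have "hcoeff (hmap h f * hmap h g) q =
          (\<Sum>a | a \<in> hsupp f \<and> q - a \<in> hsupp g. hcoeff (hmap h f) a * hcoeff (hmap h g) (q - a))"
      proof (rule hcoeff_times_superset)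
        show "finite {a. a \<in> hsupp f \<and> q - a \<in> hsupp g}"
          by (rule finite_antidiagonal) simp_all
      qed (auto simp: c in_hsupp)
      then show "hcoeff (hmap h (f * g)) q = hcoeff (hmap h f * hmap h g) q"
        by (simp add: c hcoeff_times h.hom_sum h.hom_mult)
    qed
  qed (auto intro!: hahn_eqI simp: c hcoeff_1)
qed

interpretation hreal: comm_ring_hom hreal
  unfolding hreal_def by (rule hmap_comm_ring_hom) (unfold_locales; simp)

interpretation hconst: comm_ring_hom "hmap (\<lambda>z _. z) :: complex hahn \<Rightarrow> ('m \<Rightarrow> complex) hahn"
  by (rule hmap_comm_ring_hom) (unfold_locales; simp add: fun_eq_iff)

interpretation hcnj: comm_ring_hom "hcnj :: ('m \<Rightarrow> complex) hahn \<Rightarrow> ('m \<Rightarrow> complex) hahn"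
  unfolding hcnj_def by (rule hmap_comm_ring_hom) (unfold_locales; simp add: fun_eq_iff)

lemma hcoeff_hreal: "hcoeff (hreal a) q = complex_of_real (hcoeff a q)"
  by (simp add: hreal_def hcoeff_hmap)

lemma hreal_inject [simp]: "hreal a = hreal b \<longleftrightarrow> a = b"
  by (metis hcoeff_hreal hahn_eqI of_real_eq_iff)

lemma hle_hreal [simp]: "hle (hreal a) (hreal b) \<longleftrightarrow> a \<le> b"
  by (auto simp: hle_def)

lemma hle_0_realE:
  assumes "hle 0 z"
  obtains a where "z = hreal a" "0 \<le> a"
  using assms by (metis hle_def hreal.hom_zero hreal_inject)

lemma cnj_hreal: "hmap cnj (hreal a) = hreal a"
  by (rule hahn_eqI) (simp add: hcoeff_hmap hcoeff_hreal)

lemma hii_sq [simp]: "hii * hii = - 1"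
  unfolding hii_def by (rule hahn_eqI) (simp add: hcoeff_hmonom_times hcoeff_hmonom hcoeff_1)

lemma hii_hii_left [simp]: "hii * (hii * z) = - z"
  by (simp flip: mult.assoc)

lemma hii_nonzero [simp]: "hii \<noteq> 0"
proof
  assume "hii = 0"
  then show False using hii_sq by simp
qed

lemma cnj_hii: "hmap cnj hii = - hii"
  by (rule hahn_eqI) (simp add: hcoeff_hmap hii_def hcoeff_hmonom)

lemma hbar_nonzero [simp]: "hbar \<noteq> 0"
proof
  assume "hbar = 0"
  then have "hcoeff hbar 1 = 0" by simp
  then show False by (simp add: hbar_def hcoeff_hmonom)
qed

lemma two_eq_hreal: "2 = hreal 2"
  using hreal.hom_add[of 1 1] by simp

lemma two_nonzero [simp]: "(2 :: complex hahn) \<noteq> 0"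
proof
  assume "(2 :: complex hahn) = 0"
  then have "hreal 2 = hreal 0" by (simp add: two_eq_hreal[symmetric])
  then have "(2 :: real hahn) = 0" by (rule hreal_inject[THEN iffD1])
  then show False by simp
qed

lemma hreal_half: "hreal a / 2 = hreal (a / 2)"
proof -
  have "hreal (a / 2) * 2 = hreal (a / 2 * 2)"
    by (simp only: two_eq_hreal hreal.hom_mult)
  then show ?thesis by (simp add: divide_eq_eq)
qed

lemma hcnj_hscale:
  fixes F :: "('m \<Rightarrow> complex) hahn"
  shows "hcnj (hscale c F) = hscale (hmap cnj c) (hcnj F)"
proof -
  have "hcnj (hmap (\<lambda>z _. z) c :: ('m \<Rightarrow> complex) hahn) = hmap (\<lambda>z _. z) (hmap cnj c)"
    by (rule hahn_eqI) (simp add: hcnj_def hcoeff_hmap fun_eq_iff)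
  then show ?thesis by (simp add: hscale_def hcnj.hom_mult)
qed

lemma hscale_zero_right [simp]: "hscale c 0 = 0"
  by (simp add: hscale_def)

lemma hscale_one [simp]: "hscale 1 F = F"
  by (simp add: hscale_def)

lemma hscale_minus_one: "hscale (- 1) F = - F"
  by (simp add: hscale_def hconst.hom_uminus)

section \<open>Smooth functions form a vector space\<close>

text \<open>Needed because the derivative of \<open>c f + g\<close> has the expected form only at points of \<open>S\<close>, whereas
  \<open>Ck_on\<close> differentiates functions that are defined everywhere.\<close>

lemma Ck_on_cong:
  assumes "open S"
  shows "(\<And>x. x \<in> S \<Longrightarrow> f x = g x) \<Longrightarrow> Ck_on k S f \<Longrightarrow> Ck_on k S g"
proof (induction k arbitrary: f g)
  case 0
  then show ?case by (simp cong: continuous_on_cong)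
next
  case (Suc k)
  have d: "(g has_derivative frechet_derivative f (at x)) (at x)" if "x \<in> S" for x
  proof -
    have "(f has_derivative frechet_derivative f (at x)) (at x)"
      using Suc.prems(2) that frechet_derivative_works by auto
    then show ?thesis
      by (rule has_derivative_transform_within_open[OF _ assms that]) (simp add: Suc.prems(1))
  qed
  have eq: "frechet_derivative f (at x) = frechet_derivative g (at x)" if "x \<in> S" for x
    by (rule frechet_derivative_at[OF d[OF that]])
  show ?case
    unfolding Ck_on.simps
  proof (intro conjI ballI allI)
    show "g differentiable at x" if "x \<in> S" for x using d[OF that] by (auto simp: differentiable_def)
    fix v
    show "Ck_on k S (\<lambda>x. frechet_derivative g (at x) v)"
      by (rule Suc.IH[of "\<lambda>x. frechet_derivative f (at x) v"]) (use Suc.prems(2) eq in auto)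
  qed
qed

lemma Ck_on_const: "Ck_on k S (\<lambda>_. c)"
proof (induction k arbitrary: c)
  case (Suc k)
  have "frechet_derivative (\<lambda>_. c) (at x) = (\<lambda>_. 0)" for x
    by (rule frechet_derivative_at[symmetric]) simp
  then show ?case using Suc.IH[of 0] by simp
qed simp

lemma Ck_on_lin:
  fixes f g :: "'a::real_normed_vector \<Rightarrow> complex"
  assumes "open S"
  shows "Ck_on k S f \<Longrightarrow> Ck_on k S g \<Longrightarrow> Ck_on k S (\<lambda>x. c * f x + g x)"
proof (induction k arbitrary: f g)
  case 0
  then show ?case by (auto intro!: continuous_intros)
next
  case (Suc k)
  have d: "((\<lambda>x. c * f x + g x) has_derivative
      (\<lambda>v. c * frechet_derivative f (at x) v + frechet_derivative g (at x) v)) (at x)"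
    if "x \<in> S" for x
  proof -
    have "(f has_derivative frechet_derivative f (at x)) (at x)"
      "(g has_derivative frechet_derivative g (at x)) (at x)"
      using Suc.prems that by (simp_all add: frechet_derivative_works[symmetric])
    then show ?thesis by (intro has_derivative_add has_derivative_mult_right)
  qed
  show ?case
    unfolding Ck_on.simps
  proof (intro conjI ballI allI)
    show "(\<lambda>x. c * f x + g x) differentiable at x" if "x \<in> S" for x
      using d[OF that] by (auto simp: differentiable_def)
    fix v
    have "Ck_on k S (\<lambda>x. c * frechet_derivative f (at x) v + frechet_derivative g (at x) v)"
      by (rule Suc.IH) (use Suc.prems in auto)
    then show "Ck_on k S (\<lambda>x. frechet_derivative (\<lambda>x. c * f x + g x) (at x) v)"
      by (rule Ck_on_cong[OF assms, rotated]) (simp add: frechet_derivative_at[OF d, symmetric])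
  qed
qed

lemma Cinf_const: "(\<lambda>_. c) \<in> Cinf A"
  by (auto simp: Cinf_def smooth_on_def comp_def Ck_on_const)

lemma Cinf_lin:
  fixes f g :: "'m::{t2_space,second_countable_topology} \<Rightarrow> complex"
  assumes A: "smooth_atlas A" and f: "f \<in> Cinf A" and g: "g \<in> Cinf A"
  shows "(\<lambda>x. c * f x + g x) \<in> Cinf A"
  unfolding Cinf_def
proof clarify
  fix U \<phi> assume c: "(U, \<phi>) \<in> A"
  have "open (\<phi> ` U)" using A c by (auto simp: smooth_atlas_def)
  moreover have "smooth_on (\<phi> ` U) (f \<circ> inv_into U \<phi>)" "smooth_on (\<phi> ` U) (g \<circ> inv_into U \<phi>)"
    using f g c by (auto simp: Cinf_def)
  ultimately show "smooth_on (\<phi> ` U) ((\<lambda>x. c * f x + g x) \<circ> inv_into U \<phi>)"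
    by (auto simp: smooth_on_def comp_def intro: Ck_on_lin)
qed

lemma Cinf_sum:
  fixes f :: "'i \<Rightarrow> 'm::{t2_space,second_countable_topology} \<Rightarrow> complex"
  assumes A: "smooth_atlas A" and f: "\<And>i. i \<in> I \<Longrightarrow> f i \<in> Cinf A"
  shows "(\<Sum>i\<in>I. (\<lambda>_. c i) * f i) \<in> Cinf A"
  using f
proof (induction I rule: infinite_finite_induct)
  case (insert i I)
  define g where "g = (\<Sum>i\<in>I. (\<lambda>_. c i) * f i)"
  have "(\<Sum>i\<in>insert i I. (\<lambda>_. c i) * f i) = (\<lambda>x. c i * f i x + g x)"
    unfolding g_def sum.insert[OF insert.hyps] by (simp add: plus_fun_def times_fun_def)
  moreover have "(\<lambda>x. c i * f i x + g x) \<in> Cinf A"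
  proof (rule Cinf_lin[OF A])
    show "f i \<in> Cinf A" by (rule insert.prems) simp
    show "g \<in> Cinf A" unfolding g_def by (rule insert.IH) (simp add: insert.prems)
  qed
  ultimately show ?case by (simp only:)
qed (use Cinf_const[of "0 :: complex" A] in \<open>simp_all add: zero_fun_def\<close>)

section \<open>The Hermitian form of a state\<close>

locale quantum_state =
  fixes A :: "('m::{t2_space,second_countable_topology}, 'e::real_normed_vector) chart set"
    and \<omega> :: "'m two_form"
    and star :: "('m \<Rightarrow> complex) hahn \<Rightarrow> ('m \<Rightarrow> complex) hahn \<Rightarrow> ('m \<Rightarrow> complex) hahn"
    and \<rho> :: "('m \<Rightarrow> complex) hahn \<Rightarrow> complex hahn"
  assumes atlas: "smooth_atlas A"
    and star: "star_product A \<omega> star"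
    and state: "star_state A star \<rho>"
begin

abbreviation "V \<equiv> Cinf_series A"

lemma V_zero: "0 \<in> V"
  using Cinf_const[of "0 :: complex" A] by (simp add: Cinf_series_def zero_fun_def)

lemma V_one: "1 \<in> V"
  using Cinf_const[of "0 :: complex" A] Cinf_const[of "1 :: complex" A]
  by (simp add: Cinf_series_def hcoeff_1 zero_fun_def one_fun_def)

lemma V_lin:
  assumes "F \<in> V" "G \<in> V"
  shows "hscale c F + G \<in> V"
  unfolding Cinf_series_def mem_Collect_eq
proof
  fix q
  define I where "I = {a. a \<in> hsupp c \<and> q - a \<in> hsupp F}"
  have "hcoeff (hscale c F) q = (\<Sum>a\<in>I. hcoeff (hmap (\<lambda>z _. z) c) a * hcoeff F (q - a))"
    unfolding hscale_def
  proof (rule hcoeff_times_superset)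
    show "finite I" unfolding I_def by (rule finite_antidiagonal) simp_all
  qed (auto simp: I_def in_hsupp hcoeff_hmap zero_fun_def)
  also have "\<dots> = (\<Sum>a\<in>I. (\<lambda>_. hcoeff c a) * hcoeff F (q - a))"
    by (simp add: hcoeff_hmap zero_fun_def)
  also have "\<dots> \<in> Cinf A"
    by (rule Cinf_sum[OF atlas]) (use assms(1) in \<open>auto simp: Cinf_series_def\<close>)
  finally have "(\<lambda>x. 1 * hcoeff (hscale c F) q x + hcoeff G q x) \<in> Cinf A"
    using assms(2) by (intro Cinf_lin[OF atlas]) (auto simp: Cinf_series_def)
  then show "hcoeff (hscale c F + G) q \<in> Cinf A"
    by (simp add: plus_fun_def)
qed

lemma star_closed:
  assumes "F \<in> V" "G \<in> V"
  shows "star F G \<in> V"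
proof -
  obtain C where C: "\<forall>k. bidifferential A (C k)"
    "\<forall>F\<in>V. \<forall>G\<in>V. \<forall>q. hcoeff (star F G) q =
      (\<Sum>(k, a)\<in>star_index F G q. C k (hcoeff F a) (hcoeff G (q - of_nat k - a)))"
    using star unfolding star_product_def by blast
  have "(\<Sum>x\<in>star_index F G q. (\<lambda>_. 1) *
      (case x of (k, a) \<Rightarrow> C k (hcoeff F a) (hcoeff G (q - of_nat k - a)))) \<in> Cinf A" for q
    by (rule Cinf_sum[OF atlas])
      (use assms C(1) in \<open>auto simp: Cinf_series_def bidifferential_def\<close>)
  moreover have "(\<lambda>_. 1) * f = f" for f :: "'m \<Rightarrow> complex" by (simp add: fun_eq_iff)
  ultimately have "hcoeff (star F G) q \<in> Cinf A" for q using C(2) assms by simp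
  then show ?thesis by (simp add: Cinf_series_def)
qed

text \<open>Only the term with \<open>k = 0\<close> and with the exponent \<open>0\<close> of the constant \<open>1\<close> survives in the
  expansion of the product.\<close>

lemma star_unit:
  assumes F: "F \<in> V"
  shows "star 1 F = F" "star F 1 = F"
proof -
  obtain C where C: "\<forall>F\<in>V. \<forall>G\<in>V. \<forall>q. hcoeff (star F G) q =
      (\<Sum>(k, a)\<in>star_index F G q. C k (hcoeff F a) (hcoeff G (q - of_nat k - a)))"
    "\<forall>f\<in>Cinf A. \<forall>g\<in>Cinf A. C 0 f g = f * g"
    "\<forall>k\<ge>1. \<forall>f\<in>Cinf A. C k 1 f = 0 \<and> C k f 1 = 0"
    using star unfolding star_product_def by blast
  have coeff: "hcoeff F p \<in> Cinf A" for p using F by (simp add: Cinf_series_def)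
  have one: "(1 :: 'm \<Rightarrow> complex) \<in> Cinf A" using Cinf_const[of "1 :: complex" A] by (simp add: one_fun_def)
  show "star 1 F = F"
  proof (rule hahn_eqI)
    fix q
    have "hcoeff (star 1 F) q =
        (\<Sum>(k, a)\<in>star_index 1 F q. C k (hcoeff 1 a) (hcoeff F (q - of_nat k - a)))"
      using C(1) V_one F by blast
    also have "\<dots> = (\<Sum>x\<in>star_index 1 F q. if x = (0, 0) then hcoeff F q else 0)"
      by (rule sum.cong)
        (auto simp: star_index_def in_hsupp hcoeff_1 C(2) C(3) coeff one Suc_le_eq split: if_splits)
    also have "\<dots> = hcoeff F q"
      by (subst sum.delta[OF finite_star_index]) (auto simp: star_index_def in_hsupp hcoeff_1)
    finally show "hcoeff (star 1 F) q = hcoeff F q" .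
  qed
  show "star F 1 = F"
  proof (rule hahn_eqI)
    fix q
    have "hcoeff (star F 1) q =
        (\<Sum>(k, a)\<in>star_index F 1 q. C k (hcoeff F a) (hcoeff 1 (q - of_nat k - a)))"
      using C(1) V_one F by blast
    also have "\<dots> = (\<Sum>x\<in>star_index F 1 q. if x = (0, q) then hcoeff F q else 0)"
      by (rule sum.cong)
        (auto simp: star_index_def in_hsupp hcoeff_1 C(2) C(3) coeff one Suc_le_eq split: if_splits)
    also have "\<dots> = hcoeff F q"
      by (subst sum.delta[OF finite_star_index]) (auto simp: star_index_def in_hsupp hcoeff_1)
    finally show "hcoeff (star F 1) q = hcoeff F q" .
  qed
qed

lemma rho_lin: "F \<in> V \<Longrightarrow> G \<in> V \<Longrightarrow> \<rho> (hscale c F + G) = c * \<rho> F + \<rho> G"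
  using state by (simp add: star_state_def)

lemma rho_one: "\<rho> 1 = 1"
  using state by (simp add: star_state_def)

lemma rho_zero: "\<rho> 0 = 0"
  using rho_lin[OF V_zero V_zero, of "- 1"] by simp

definition form where "form F G = \<rho> (star F G)"

lemma form_lin_left:
  assumes "F \<in> V" "G \<in> V" "H \<in> V"
  shows "form (hscale c F + G) H = c * form F H + form G H"
proof -
  have "star (hscale c F + G) H = hscale c (star F H) + star G H"
    using star assms unfolding star_product_def by blast
  then show ?thesis by (simp add: form_def rho_lin star_closed assms)
qed

lemma form_lin_right:
  assumes "F \<in> V" "G \<in> V" "H \<in> V"
  shows "form H (hscale c F + G) = c * form H F + form H G"
proof -
  have "star H (hscale c F + G) = hscale c (star H F) + star H G"
    using star assms unfolding star_product_def by blast
  then show ?thesis by (simp add: form_def rho_lin star_closed assms)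
qed

lemma form_zero:
  assumes "F \<in> V"
  shows "form 0 F = 0" "form F 0 = 0"
  using form_lin_left[OF V_zero V_zero assms, of "- 1"] form_lin_right[OF V_zero V_zero assms, of "- 1"]
  by simp_all

lemma form_one:
  assumes "F \<in> V"
  shows "form 1 F = \<rho> F" "form F 1 = \<rho> F"
  by (simp_all add: form_def star_unit assms)

definition hermitian where "hermitian F \<longleftrightarrow> F \<in> V \<and> hcnj F = F"

lemma hermitian_one: "hermitian 1"
  by (simp add: hermitian_def V_one)

lemma hermitian_zero: "hermitian 0"
  by (simp add: hermitian_def V_zero)

lemma hermitian_lin: "hermitian F \<Longrightarrow> hermitian G \<Longrightarrow> hermitian (hscale (hreal c) F + G)"
  by (simp add: hermitian_def V_lin hcnj.hom_add hcnj_hscale cnj_hreal)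

lemma form_nonneg:
  assumes "hermitian F"
  shows "hle 0 (form F F)"
proof -
  have "F \<in> V" "hcnj F = F" using assms by (auto simp: hermitian_def)
  then have "hle 0 (\<rho> (star (hcnj F) F))" using state unfolding star_state_def by blast
  then show ?thesis using \<open>hcnj F = F\<close> by (simp add: form_def)
qed

text \<open>Positivity for the non-Hermitian element \<open>F + iG\<close>, expanded. The axiom conjugates before
  multiplying, so the left factor is \<open>F - iG\<close> and bilinearity suffices.\<close>

lemma form_complex_nonneg:
  assumes "hermitian F" "hermitian G"
  shows "hle 0 (form F F + form G G + hii * (form F G - form G F))"
proof -
  have V: "F \<in> V" "G \<in> V" and c: "hcnj F = F" "hcnj G = G" using assms by (auto simp: hermitian_def)
  define H where "H = hscale hii G + F"
  have H: "H \<in> V" using V by (simp add: H_def V_lin)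
  have cH: "hcnj H = hscale (- hii) G + F"
    by (simp add: H_def hcnj.hom_add hcnj_hscale cnj_hii c)
  have "hle 0 (\<rho> (star (hcnj H) H))" using state H by (simp add: star_state_def)
  also have "\<rho> (star (hcnj H) H) = form (hscale (- hii) G + F) H"
    by (simp add: form_def cH)
  also have "\<dots> = - hii * form G H + form F H"
    by (rule form_lin_left) (use V H in auto)
  also have "\<dots> = - hii * (hii * form G G + form G F) + (hii * form F G + form F F)"
    using V by (simp add: H_def form_lin_right)
  also have "\<dots> = form F F + form G G + hii * (form F G - form G F)"
    by (simp add: algebra_simps)
  finally show ?thesis .
qed

text \<open>For Hermitian arguments the form is \<open>sym_part + i alt_part\<close> with both parts real
  (\<open>hreal_sym_part\<close>, \<open>hreal_alt_part\<close>), and then the preimages under \<open>hreal\<close> are the intended ones.\<close>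

definition sym_part where
  "sym_part F G = inv_into UNIV hreal ((form F G + form G F) / 2)"

definition alt_part where
  "alt_part F G = inv_into UNIV hreal ((form F G - form G F) / (2 * hii))"

text \<open>Polarization: \<open>form F G + form G F\<close> is the difference of the real values of the form at
  \<open>F + G\<close>, \<open>F\<close> and \<open>G\<close>.\<close>

lemma hreal_sym_part:
  assumes "hermitian F" "hermitian G"
  shows "hreal (sym_part F G) = (form F G + form G F) / 2"
proof -
  have V: "F \<in> V" "G \<in> V" using assms by (auto simp: hermitian_def)
  define H where "H = hscale 1 F + G"
  have H: "hermitian H" using hermitian_lin[OF assms, of 1] by (simp add: H_def)
  have HV: "H \<in> V" using H by (simp add: hermitian_def)
  obtain a b c where abc: "form F F = hreal a" "form G G = hreal b" "form H H = hreal c"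
    using form_nonneg assms H by (metis hle_0_realE)
  have "form H H = form F H + form G H"
    using form_lin_left[OF V HV, of 1] by (simp add: H_def)
  also have "\<dots> = form F F + form F G + (form G F + form G G)"
    using form_lin_right[OF V V(1), of 1] form_lin_right[OF V V(2), of 1] by (simp add: H_def)
  finally have "form F G + form G F = form H H - form F F - form G G"
    by (simp add: algebra_simps)
  then have "form F G + form G F = hreal (c - a - b)"
    by (simp add: abc hreal.hom_minus)
  then have "(form F G + form G F) / 2 = hreal ((c - a - b) / 2)" by (simp only: hreal_half)
  then show ?thesis unfolding sym_part_def by (metis f_inv_into_f rangeI)
qed

lemma hreal_alt_part:
  assumes "hermitian F" "hermitian G"
  shows "hreal (alt_part F G) = (form F G - form G F) / (2 * hii)"
proof -
  obtain a b c where abc: "form F F = hreal a" "form G G = hreal b"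
    "form F F + form G G + hii * (form F G - form G F) = hreal c"
    using form_nonneg[OF assms(1)] form_nonneg[OF assms(2)] form_complex_nonneg[OF assms]
    by (metis hle_0_realE)
  have "hii * (form F G - form G F) = hreal c - form F F - form G G"
    unfolding abc(3)[symmetric] by simp
  then have *: "hii * (form F G - form G F) = hreal (c - a - b)"
    by (simp add: abc(1,2) hreal.hom_minus)
  have "z / (2 * hii) = - (hii * z) / 2" for z
  proof -
    have "- (hii * z) / 2 * (2 * hii) = - (hii * hii) * z" by (simp del: hii_sq hii_hii_left)
    then show ?thesis by (simp add: divide_eq_eq)
  qed
  then have "(form F G - form G F) / (2 * hii) = - (hii * (form F G - form G F)) / 2" .
  also have "\<dots> = hreal (- (c - a - b) / 2)"
    by (simp only: * hreal.hom_uminus[symmetric] hreal_half)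
  finally show ?thesis unfolding alt_part_def by (metis f_inv_into_f rangeI)
qed

lemma sym_part_self: "hermitian F \<Longrightarrow> hreal (sym_part F F) = form F F"
  using hreal_sym_part[of F F] by (simp add: mult_2[symmetric])

lemma sym_part_nonneg: "hermitian F \<Longrightarrow> 0 \<le> sym_part F F"
  using form_nonneg[of F] by (metis hle_hreal hreal.hom_zero sym_part_self)

text \<open>This is the domination hypothesis of \<open>det_dominated_le\<close>; the sign comes from
  \<open>i (form F G - form G F) = - 2 alt_part F G\<close>.\<close>

lemma alt_part_le:
  assumes "hermitian F" "hermitian G"
  shows "2 * alt_part F G \<le> sym_part F F + sym_part G G"
proof -
  have "form F G - form G F = 2 * hii * hreal (alt_part F G)"
    by (simp add: hreal_alt_part assms)
  then have "hii * (form F G - form G F) = - (2 * hreal (alt_part F G))"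
    by (simp add: mult.left_commute mult.assoc)
  then have "form F F + form G G + hii * (form F G - form G F) =
      hreal (sym_part F F + sym_part G G - 2 * alt_part F G)"
    by (simp add: sym_part_self assms hreal.hom_minus hreal.hom_add hreal.hom_mult two_eq_hreal)
  then have "hle (hreal 0) (hreal (sym_part F F + sym_part G G - 2 * alt_part F G))"
    using form_complex_nonneg[OF assms] by simp
  then show ?thesis by (simp only: hle_hreal diff_ge_0_iff_ge)
qed

definition lincomb where "lincomb n Y c = (\<Sum>j<(n::nat). hscale (hreal (c j)) (Y j))"

lemma lincomb_Suc: "lincomb (Suc n) Y c = hscale (hreal (c n)) (Y n) + lincomb n Y c"
  by (simp add: lincomb_def add.commute)

lemma hermitian_lincomb:
  "(\<And>j. j < n \<Longrightarrow> hermitian (Y j)) \<Longrightarrow> hermitian (lincomb n Y c)"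
proof (induction n)
  case 0
  then show ?case by (simp add: lincomb_def hermitian_zero)
next
  case (Suc n)
  then show ?case by (simp add: lincomb_Suc hermitian_lin)
qed

lemma form_lincomb_left:
  assumes "H \<in> V"
  shows "(\<And>j. j < n \<Longrightarrow> hermitian (Y j)) \<Longrightarrow>
    form (lincomb n Y c) H = (\<Sum>j<n. hreal (c j) * form (Y j) H)"
proof (induction n)
  case 0
  then show ?case by (simp add: lincomb_def form_zero assms)
next
  case (Suc n)
  have "lincomb n Y c \<in> V" "Y n \<in> V"
    using hermitian_lincomb[of n Y c] Suc.prems by (auto simp: hermitian_def)
  then show ?case using Suc assms by (simp add: lincomb_Suc form_lin_left)
qed

lemma form_lincomb_right:
  assumes "H \<in> V"
  shows "(\<And>j. j < n \<Longrightarrow> hermitian (Y j)) \<Longrightarrow>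
    form H (lincomb n Y c) = (\<Sum>j<n. hreal (c j) * form H (Y j))"
proof (induction n)
  case 0
  then show ?case by (simp add: lincomb_def form_zero assms)
next
  case (Suc n)
  have "lincomb n Y c \<in> V" "Y n \<in> V"
    using hermitian_lincomb[of n Y c] Suc.prems by (auto simp: hermitian_def)
  then show ?case using Suc assms by (simp add: lincomb_Suc form_lin_right)
qed

lemma form_lincomb:
  assumes "\<And>j. j < n \<Longrightarrow> hermitian (Y j)"
  shows "form (lincomb n Y c) (lincomb n Y d) =
    (\<Sum>i<n. \<Sum>j<n. hreal (c i) * form (Y i) (Y j) * hreal (d j))"
proof -
  have "lincomb n Y d \<in> V" using hermitian_lincomb[OF assms] by (simp add: hermitian_def)
  then have "form (lincomb n Y c) (lincomb n Y d) =
      (\<Sum>i<n. hreal (c i) * form (Y i) (lincomb n Y d))"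
    by (rule form_lincomb_left[OF _ assms])
  also have "\<dots> = (\<Sum>i<n. hreal (c i) * (\<Sum>j<n. hreal (d j) * form (Y i) (Y j)))"
    using assms by (intro sum.cong refl arg_cong2[of _ _ _ _ "(*)"] form_lincomb_right)
      (auto simp: hermitian_def)
  finally show ?thesis by (simp add: sum_distrib_left mult_ac)
qed

lemma sym_part_lincomb:
  assumes "\<And>j. j < n \<Longrightarrow> hermitian (Y j)"
  shows "sym_part (lincomb n Y c) (lincomb n Y d) =
    (\<Sum>i<n. \<Sum>j<n. c i * sym_part (Y i) (Y j) * d j)"
proof -
  have "hreal (\<Sum>i<n. \<Sum>j<n. c i * sym_part (Y i) (Y j) * d j) =
      (\<Sum>i<n. \<Sum>j<n. hreal (c i) * ((form (Y i) (Y j) + form (Y j) (Y i)) / 2) * hreal (d j))"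
    by (simp add: hreal.hom_sum hreal.hom_mult hreal_sym_part assms)
  also have "\<dots> = ((\<Sum>i<n. \<Sum>j<n. hreal (c i) * form (Y i) (Y j) * hreal (d j)) +
      (\<Sum>i<n. \<Sum>j<n. hreal (c i) * form (Y j) (Y i) * hreal (d j))) / 2"
    by (simp add: sum.distrib[symmetric] sum_divide_distrib algebra_simps add_divide_distrib)
  also have "(\<Sum>i<n. \<Sum>j<n. hreal (c i) * form (Y j) (Y i) * hreal (d j)) =
      (\<Sum>j<n. \<Sum>i<n. hreal (d j) * form (Y j) (Y i) * hreal (c i))"
    by (subst sum.swap) (simp add: mult_ac)
  also have "((\<Sum>i<n. \<Sum>j<n. hreal (c i) * form (Y i) (Y j) * hreal (d j)) + \<dots>) / 2 =
      hreal (sym_part (lincomb n Y c) (lincomb n Y d))"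
    by (simp add: hreal_sym_part hermitian_lincomb assms form_lincomb)
  finally show ?thesis by simp
qed

lemma alt_part_lincomb:
  assumes "\<And>j. j < n \<Longrightarrow> hermitian (Y j)"
  shows "alt_part (lincomb n Y c) (lincomb n Y d) =
    (\<Sum>i<n. \<Sum>j<n. c i * alt_part (Y i) (Y j) * d j)"
proof -
  have "hreal (\<Sum>i<n. \<Sum>j<n. c i * alt_part (Y i) (Y j) * d j) =
      (\<Sum>i<n. \<Sum>j<n. hreal (c i) * ((form (Y i) (Y j) - form (Y j) (Y i)) / (2 * hii)) * hreal (d j))"
    by (simp add: hreal.hom_sum hreal.hom_mult hreal_alt_part assms)
  also have "\<dots> = ((\<Sum>i<n. \<Sum>j<n. hreal (c i) * form (Y i) (Y j) * hreal (d j)) -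
      (\<Sum>i<n. \<Sum>j<n. hreal (c i) * form (Y j) (Y i) * hreal (d j))) / (2 * hii)"
    by (simp add: sum_subtractf[symmetric] sum_divide_distrib algebra_simps diff_divide_distrib)
  also have "(\<Sum>i<n. \<Sum>j<n. hreal (c i) * form (Y j) (Y i) * hreal (d j)) =
      (\<Sum>j<n. \<Sum>i<n. hreal (d j) * form (Y j) (Y i) * hreal (c i))"
    by (subst sum.swap) (simp add: mult_ac)
  also have "((\<Sum>i<n. \<Sum>j<n. hreal (c i) * form (Y i) (Y j) * hreal (d j)) - \<dots>) / (2 * hii) =
      hreal (alt_part (lincomb n Y c) (lincomb n Y d))"
    by (simp add: hreal_alt_part hermitian_lincomb assms form_lincomb)
  finally show ?thesis by simp
qed

lemma det_alt_part_le:
  assumes Y: "\<And>j. j < n \<Longrightarrow> hermitian (Y j)"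
  shows "det (mat n n (\<lambda>(j, k). alt_part (Y j) (Y k))) \<le> (\<Prod>j<n. sym_part (Y j) (Y j))"
proof -
  define S where "S = mat n n (\<lambda>(j, k). sym_part (Y j) (Y k))"
  define M where "M = mat n n (\<lambda>(j, k). alt_part (Y j) (Y k))"
  have S: "S \<in> carrier_mat n n" and M: "M \<in> carrier_mat n n" by (simp_all add: S_def M_def)
  define L where "L v = lincomb n Y (\<lambda>i. v $ i)" for v
  have L: "hermitian (L v)" for v unfolding L_def by (rule hermitian_lincomb[OF Y])
  have form_S: "u \<bullet> (S *\<^sub>v v) = sym_part (L u) (L v)" if "u \<in> carrier_vec n" "v \<in> carrier_vec n" for u v
    unfolding L_def form_eq_sum[OF S that] by (simp add: sym_part_lincomb Y S_def)
  have form_M: "u \<bullet> (M *\<^sub>v v) = alt_part (L u) (L v)" if "u \<in> carrier_vec n" "v \<in> carrier_vec n" for u v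
    unfolding L_def form_eq_sum[OF M that] by (simp add: alt_part_lincomb Y M_def)
  have "S\<^sup>T = S"
    by (rule eq_matI) (auto simp: S_def sym_part_def add.commute)
  then have "psd n S" using S by (simp add: psd_def form_S sym_part_nonneg L)
  then have "det M \<le> (\<Prod>i<n. S $$ (i, i))"
    by (rule det_dominated_le[OF _ M]) (simp add: form_S form_M alt_part_le L)
  then show ?thesis by (simp add: S_def M_def)
qed

end

section \<open>The uncertainty relation\<close>

theorem mainTheorem4:
  fixes A :: "('m::{t2_space,second_countable_topology}, 'e::real_normed_vector) chart set"
    and \<omega> :: "'m two_form"
    and star :: "('m \<Rightarrow> complex) hahn \<Rightarrow> ('m \<Rightarrow> complex) hahn \<Rightarrow> ('m \<Rightarrow> complex) hahn"
    and \<rho> :: "('m \<Rightarrow> complex) hahn \<Rightarrow> complex hahn"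
    and X :: "nat \<Rightarrow> ('m \<Rightarrow> complex) hahn"
    and n :: nat
  assumes "symplectic_manifold A \<omega>"
    and "star_product A \<omega> star"
    and "star_state A star \<rho>"
    and "\<And>j. j < n \<Longrightarrow> X j \<in> Cinf_series A"
    and "\<And>j. j < n \<Longrightarrow> hcnj (X j) = X j"
  shows "hle (det (mat n n (\<lambda>(j, k). hbar / 2 * \<rho> (star_bracket star (X j) (X k)))))
             (\<Prod>j<n. variance star \<rho> (X j))"
proof -
  interpret quantum_state A \<omega> star \<rho>
    using assms(1-3) by unfold_locales (auto simp: symplectic_manifold_def)
  have XV: "X j \<in> V" and X: "hermitian (X j)" if "j < n" for j
    using assms(4,5) that by (auto simp: hermitian_def)
  \<comment> \<open>The centered observables.\<close>
  define Y where "Y j = hscale (- \<rho> (X j)) 1 + X j" for j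
  \<comment> \<open>Expectations are real because \<open>\<rho>(X\<^sub>j)\<close> is the symmetric part of the form at \<open>1\<close> and \<open>X\<^sub>j\<close>.\<close>
  have Y: "hermitian (Y j)" if "j < n" for j
  proof -
    have "hreal (sym_part 1 (X j)) = \<rho> (X j)"
      using hreal_sym_part[OF hermitian_one X[OF that]]
      by (simp add: form_one XV[OF that] mult_2[symmetric])
    then have "Y j = hscale (hreal (- sym_part 1 (X j))) 1 + X j"
      by (simp add: Y_def hreal.hom_uminus)
    then show ?thesis using hermitian_lin[OF hermitian_one X[OF that]] by simp
  qed
  have YY: "form (Y j) (Y k) = form (X j) (X k) - \<rho> (X j) * \<rho> (X k)" if "j < n" "k < n" for j k
  proof -
    note V = V_one XV[OF that(1)] XV[OF that(2)]
    have "form (Y j) (Y k) = - \<rho> (X j) * form 1 (Y k) + form (X j) (Y k)"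
      unfolding Y_def[of j] by (rule form_lin_left) (use V Y[OF that(2)] in \<open>auto simp: hermitian_def\<close>)
    also have "form 1 (Y k) = 0"
      unfolding Y_def using V by (simp add: form_lin_right form_one rho_one)
    also have "form (X j) (Y k) = - \<rho> (X k) * \<rho> (X j) + form (X j) (X k)"
      unfolding Y_def using V by (simp add: form_lin_right form_one)
    finally show ?thesis by (simp add: mult.commute)
  qed
  have var: "variance star \<rho> (X j) = hreal (sym_part (Y j) (Y j))" if "j < n" for j
    using YY[OF that that] by (simp add: variance_def sym_part_self Y that power2_eq_square form_def)
  have bracket: "hbar / 2 * \<rho> (star_bracket star (X j) (X k)) = hreal (alt_part (Y j) (Y k))"
    if "j < n" "k < n" for j k
  proof -
    have V: "star (X j) (X k) \<in> V" "star (X k) (X j) \<in> V"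
      using star_closed XV that by auto
    define D where "D = hscale (- 1) (star (X k) (X j)) + star (X j) (X k)"
    have D: "D \<in> V" unfolding D_def using V by (simp add: V_lin)
    have "star_bracket star (X j) (X k) = hscale (1 / (hii * hbar)) D + 0"
      by (simp add: star_bracket_def D_def hscale_minus_one)
    then have "\<rho> (star_bracket star (X j) (X k)) = 1 / (hii * hbar) * \<rho> D"
      using rho_lin[OF D V_zero] by (simp add: rho_zero)
    also have "\<rho> D = form (X j) (X k) - form (X k) (X j)"
      using rho_lin[OF V(2) V(1), of "- 1"] by (simp add: D_def form_def)
    also have "\<dots> = form (Y j) (Y k) - form (Y k) (Y j)"
      by (simp add: YY that)
    finally show ?thesis by (simp add: hreal_alt_part Y that)
  qed
  have "mat n n (\<lambda>(j, k). hbar / 2 * \<rho> (star_bracket star (X j) (X k))) =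
      map_mat hreal (mat n n (\<lambda>(j, k). alt_part (Y j) (Y k)))"
    by (rule eq_matI) (simp_all add: bracket[symmetric])
  moreover have "(\<Prod>j<n. variance star \<rho> (X j)) = hreal (\<Prod>j<n. sym_part (Y j) (Y j))"
    by (simp add: hreal.hom_prod var)
  ultimately show ?thesis using det_alt_part_le[OF Y] by simp
qed

end
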